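(* Let $H$ be a complex Hilbert space and let $[0,I]$ be the set of all effects on $H$. Let $\phi:[0,I]\to[0,I]$ be a bijective affine function. Then there is an operator $U$ on $H$ which is either unitary or antiunitary such that either \[ \phi(A)=UAU^*\qquad\text{for all } A\in[0,I], \] or \[ \phi(A)=U(I-A)U^*\qquad\text{for all } A\in[0,I]. \]
   Context: $B(H)$ denotes the algebra of all bounded linear operators on $H$, and $I$ is the identity operator on $H$. The operator interval $[0,I]$ is the set of all positive operators $A\in B(H)$ with $A\le I$, where $\le$ is the usual order on self-adjoint operators; its elements are called effects, and it is a convex subset of $B(H)$. A function $\psi:C\to Y$ from a convex subset $C$ of a complex linear space to a complex linear space $Y$ is affine if $\psi(\lambda x+(1-\lambda)y)=\lambda\psi(x)+(1-\lambda)\psi(y)$ for all $x,y\in C$ and $\lambda\in[0,1]$. An antiunitary operator $U$ on $H$ is a conjugate-linear bijection with $\langle Ux,Uy\rangle=\overline{\langle x,y\rangle}$ for all $x,y\in H$; its adjoint is $U^*=U^{-1}$. *)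

theory Defs
  imports "HOL-Analysis.Analysis"
begin

section \<open>Complex Hilbert spaces\<close>

class complex_vector = real_vector +
  fixes scaleC :: "complex \<Rightarrow> 'a \<Rightarrow> 'a" (infixr "*\<^sub>C" 75)
  assumes scaleC_add_right: "c *\<^sub>C (x + y) = c *\<^sub>C x + c *\<^sub>C y"
    and scaleC_add_left: "(c + d) *\<^sub>C x = c *\<^sub>C x + d *\<^sub>C x"
    and scaleC_scaleC: "c *\<^sub>C (d *\<^sub>C x) = (c * d) *\<^sub>C x"
    and scaleC_one: "1 *\<^sub>C x = x"
    and scaleR_scaleC: "r *\<^sub>R x = complex_of_real r *\<^sub>C x"

lemma vector_space_scaleC: "vector_space (scaleC :: complex \<Rightarrow> 'a \<Rightarrow> 'a::complex_vector)"
  by unfold_locales (simp_all add: scaleC_add_right scaleC_add_left scaleC_scaleC scaleC_one)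

text \<open>The inner product is linear in the first argument. Completeness and boundedness of
  operators refer to the norm of \<^class>\<open>real_normed_vector\<close>, which is required to be the
  norm induced by the inner product.\<close>

class complex_inner = complex_vector + real_normed_vector +
  fixes cinner :: "'a \<Rightarrow> 'a \<Rightarrow> complex"
  assumes cinner_add_left: "cinner (x + y) z = cinner x z + cinner y z"
    and cinner_scaleC_left: "cinner (c *\<^sub>C x) y = c * cinner x y"
    and cinner_commute: "cinner x y = cnj (cinner y x)"
    and cinner_self_nonneg: "0 \<le> Re (cinner x x)"
    and cinner_self_eq_zero: "cinner x x = 0 \<longleftrightarrow> x = 0"
    and norm_eq_sqrt_cinner: "norm x = sqrt (Re (cinner x x))"

class chilbert_space = complex_inner + complete_space

instantiation complex :: chilbert_space
begin

definition scaleC_complex :: "complex \<Rightarrow> complex \<Rightarrow> complex"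
  where "scaleC_complex c x = c * x"

definition cinner_complex :: "complex \<Rightarrow> complex \<Rightarrow> complex"
  where "cinner_complex x y = x * cnj y"

instance
proof
  fix x y z c d :: complex and r :: real
  show "c *\<^sub>C (x + y) = c *\<^sub>C x + c *\<^sub>C y" "(c + d) *\<^sub>C x = c *\<^sub>C x + d *\<^sub>C x"
    "c *\<^sub>C (d *\<^sub>C x) = (c * d) *\<^sub>C x" "1 *\<^sub>C x = x"
    "r *\<^sub>R x = complex_of_real r *\<^sub>C x"
    by (simp_all add: scaleC_complex_def distrib_left distrib_right scaleR_conv_of_real)
  show "cinner (x + y) z = cinner x z + cinner y z" "cinner (c *\<^sub>C x) y = c * cinner x y"
    "cinner x y = cnj (cinner y x)" "cinner x x = 0 \<longleftrightarrow> x = 0"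
    by (simp_all add: scaleC_complex_def cinner_complex_def distrib_right)
  show "0 \<le> Re (cinner x x)" "norm x = sqrt (Re (cinner x x))"
    by (simp_all add: cinner_complex_def cmod_def power2_eq_square)
qed

end

lemma cinner_diff_right:
  fixes x y z :: "'a::complex_inner"
  shows "cinner x (y - z) = cinner x y - cinner x z"
proof -
  have "cinner y x = cinner (y - z) x + cinner z x"
    by (simp flip: cinner_add_left)
  then have "cnj (cinner y x) = cnj (cinner (y - z) x) + cnj (cinner z x)"
    by simp
  then show ?thesis
    by (simp flip: cinner_commute)
qed

lemma cinner_right_ext:
  fixes y z :: "'a::complex_inner"
  assumes "\<And>x. cinner x y = cinner x z"
  shows "y = z"
proof -
  have "cinner (y - z) (y - z) = 0"
    using assms[of "y - z"] by (simp add: cinner_diff_right)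
  then show ?thesis
    by (simp add: cinner_self_eq_zero)
qed


section \<open>Operators\<close>

abbreviation clinear :: "('a::complex_vector \<Rightarrow> 'b::complex_vector) \<Rightarrow> bool"
  where "clinear \<equiv> Vector_Spaces.linear scaleC scaleC"

definition antilinear :: "('a::complex_vector \<Rightarrow> 'b::complex_vector) \<Rightarrow> bool"
  where "antilinear f \<longleftrightarrow>
    (\<forall>x y. f (x + y) = f x + f y) \<and> (\<forall>c x. f (c *\<^sub>C x) = cnj c *\<^sub>C f x)"

text \<open>The elements of \<open>'a \<Rightarrow>\<^sub>L 'a\<close> are the bounded real-linear maps, so \<open>B(H)\<close> consists of
  those which are moreover complex-linear.\<close>

definition bounded_operators :: "('a::complex_inner \<Rightarrow>\<^sub>L 'a) set"
  where "bounded_operators = {A. clinear (blinfun_apply A)}"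

definition selfadjoint :: "('a::complex_inner \<Rightarrow>\<^sub>L 'a) \<Rightarrow> bool"
  where "selfadjoint A \<longleftrightarrow> A \<in> bounded_operators \<and> (\<forall>x y. cinner (A x) y = cinner x (A y))"

text \<open>The usual order on self-adjoint operators; for these the numbers \<open>cinner (A x) x\<close>
  are real.\<close>

definition op_le :: "('a::complex_inner \<Rightarrow>\<^sub>L 'a) \<Rightarrow> ('a \<Rightarrow>\<^sub>L 'a) \<Rightarrow> bool"
  where "op_le A B \<longleftrightarrow>
    selfadjoint A \<and> selfadjoint B \<and> (\<forall>x. Re (cinner (A x) x) \<le> Re (cinner (B x) x))"

definition effects :: "('a::complex_inner \<Rightarrow>\<^sub>L 'a) set"
  where "effects = {A \<in> bounded_operators. op_le 0 A \<and> op_le A id_blinfun}"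

text \<open>Only real coefficients occur, so real vector spaces suffice here.\<close>

definition affine_on :: "'a::real_vector set \<Rightarrow> ('a \<Rightarrow> 'b::real_vector) \<Rightarrow> bool"
  where "affine_on C f \<longleftrightarrow>
    (\<forall>x\<in>C. \<forall>y\<in>C. \<forall>t\<in>{0..1::real}.
      f (t *\<^sub>R x + (1 - t) *\<^sub>R y) = t *\<^sub>R f x + (1 - t) *\<^sub>R f y)"


section \<open>Unitary and antiunitary operators\<close>

definition unitary :: "('a::complex_inner \<Rightarrow> 'a) \<Rightarrow> bool"
  where "unitary U \<longleftrightarrow> clinear U \<and> bij U \<and> (\<forall>x y. cinner (U x) (U y) = cinner x y)"

definition antiunitary :: "('a::complex_inner \<Rightarrow> 'a) \<Rightarrow> bool"
  where "antiunitary U \<longleftrightarrow>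
    antilinear U \<and> bij U \<and> (\<forall>x y. cinner (U x) (U y) = cnj (cinner x y))"

text \<open>The usual adjoint for linear operators; an antiunitary operator has its inverse as adjoint.
  On the zero space, where an operator is both, the two clauses agree.\<close>

definition op_adjoint :: "('a::complex_inner \<Rightarrow> 'a) \<Rightarrow> 'a \<Rightarrow> 'a"
  where "op_adjoint U =
    (if antiunitary U then inv U else (THE V. \<forall>x y. cinner (U x) y = cinner x (V y)))"

lemma op_adjoint_antiunitary:
  assumes "antiunitary U"
  shows "op_adjoint U = inv U" "cinner (U x) y = cnj (cinner x (op_adjoint U y))"
proof -
  show eq: "op_adjoint U = inv U"
    using assms by (simp add: op_adjoint_def)
  have "U (inv U y) = y"
    using assms by (simp add: antiunitary_def bij_is_surj surj_f_inv_f)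
  then show "cinner (U x) y = cnj (cinner x (op_adjoint U y))"
    using assms unfolding eq antiunitary_def by metis
qed

lemma op_adjoint_eqI:
  assumes "\<not> antiunitary U" "\<And>x y. cinner (U x) y = cinner x (V y)"
  shows "op_adjoint U = V"
proof -
  have "(THE V. \<forall>x y. cinner (U x) y = cinner x (V y)) = V"
  proof (rule the_equality)
    fix W
    assume W: "\<forall>x y. cinner (U x) y = cinner x (W y)"
    show "W = V"
    proof
      show "W y = V y" for y
        by (rule cinner_right_ext) (simp flip: W[rule_format] assms(2))
    qed
  qed (use assms(2) in simp)
  then show ?thesis
    using assms(1) by (simp add: op_adjoint_def)
qed

lemma op_adjoint_unitary:
  assumes "unitary U"
  shows "op_adjoint U = inv U" "cinner (U x) y = cinner x (op_adjoint U y)"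
proof -
  have adj: "cinner (U x) y = cinner x (inv U y)" for x y
  proof -
    have "U (inv U y) = y"
      using assms by (simp add: unitary_def bij_is_surj surj_f_inv_f)
    then show ?thesis
      using assms unfolding unitary_def by metis
  qed
  show eq: "op_adjoint U = inv U"
    using op_adjoint_eqI[OF _ adj] op_adjoint_antiunitary(1) by blast
  show "cinner (U x) y = cinner x (op_adjoint U y)"
    unfolding eq by (rule adj)
qed

end

theory Submission
  imports Defs
begin

text \<open>
  A bijection \<open>\<phi>\<close> of the effects that respects convex combinations respects everything that can
  be expressed by convexity, and this determines enough of the operator structure.

  The set of effects is \<open>I/2\<close> plus half of the unit ball of the real space of self-adjoint operators,
  so \<open>\<phi>\<close> is the restriction of an affine map of that space, whose linear part is called \<open>lin\<close>
  (\<open>image_centre_add\<close>, \<open>lin_add\<close>, \<open>lin_scaleR\<close>). As \<open>I/2\<close> is the only centre of symmetry, it is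
  fixed. The extreme points are the projections (\<open>extreme_effect_iff\<close>), so these are permuted. Among
  them \<open>0\<close> and \<open>I\<close> are the only isolated ones, hence \<open>\<phi>\<close> fixes or exchanges them
  (\<open>zero_preimage\<close>). In the second case \<open>A \<mapsto> \<phi> (I - A)\<close> fixes them, which accounts for the two
  alternatives of the theorem.

  Let \<open>\<phi>\<close> fix \<open>0\<close> and \<open>I\<close>. Then \<open>lin\<close> extends \<open>\<phi>\<close> and preserves the order, so it maps minimal
  projections, those onto a line, to minimal projections (\<open>image_rank1_unit\<close>). A positive
  unital map that sends the projection onto the line of \<open>x\<close> to the one onto the line of \<open>u\<close>
  satisfies \<open>\<langle>lin A u, u\<rangle> = \<langle>A x, x\<rangle>\<close> for all self-adjoint \<open>A\<close> and unit vectors \<open>x\<close>, \<open>u\<close>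
  (\<open>qform_image_le\<close>, \<open>qform_lin\<close>): the positive functional on the left has the value \<open>1\<close> at the
  projection onto the line of \<open>x\<close>, and there is only one such state.

  This one identity serves twice. Taking projections onto lines for \<open>A\<close>, it says that \<open>\<phi>\<close>
  preserves transition probabilities, the hypothesis of Wigner's theorem. Here Wigner's theorem is
  easy because \<open>lin\<close> is real linear: fix the phase of the image of one unit vector \<open>e\<close>; the images of
  the vectors \<open>e + x\<close> with \<open>x\<close> orthogonal to \<open>e\<close> then have a canonical phase and depend real linearly on
  \<open>x\<close>, which yields a linear or conjugate-linear isometry \<open>U\<close> implementing \<open>\<phi>\<close> on the projections onto
  lines (\<open>isometry_exists\<close>). For general \<open>A\<close> the identity says that \<open>\<phi> A\<close> and \<open>U A U\<^sup>*\<close> have the same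
  quadratic form, hence are equal (\<open>image_apply_isometry\<close>). The argument is the same in every
  dimension.
\<close>

section \<open>Complex inner product spaces\<close>

lemma cinner_add_right:
  fixes x y z :: "'a::complex_inner"
  shows "cinner x (y + z) = cinner x y + cinner x z"
  by (metis cinner_commute cinner_add_left complex_cnj_add)

lemma cinner_scaleC_right:
  fixes x y :: "'a::complex_inner"
  shows "cinner x (c *\<^sub>C y) = cnj c * cinner x y"
  by (metis cinner_commute cinner_scaleC_left complex_cnj_mult)

lemma cinner_scaleR_left:
  fixes x y :: "'a::complex_inner"
  shows "cinner (r *\<^sub>R x) y = of_real r * cinner x y"
  by (simp add: scaleR_scaleC cinner_scaleC_left)

lemma cinner_scaleR_right:
  fixes x y :: "'a::complex_inner"
  shows "cinner x (r *\<^sub>R y) = of_real r * cinner x y"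
  by (simp add: scaleR_scaleC cinner_scaleC_right)

lemma cinner_zero_left: "cinner 0 (x::'a::complex_inner) = 0"
  using cinner_add_left[of 0 0 x] by simp

lemma cinner_zero_right: "cinner (x::'a::complex_inner) 0 = 0"
  using cinner_add_right[of x 0 0] by simp

lemma cinner_minus_left: "cinner (- x) (y::'a::complex_inner) = - cinner x y"
  using cinner_scaleR_left[of "-1" x y] by simp

lemma cinner_minus_right: "cinner x (- y::'a::complex_inner) = - cinner x y"
  using cinner_scaleR_right[of x "-1" y] by simp

lemma cinner_diff_left:
  fixes x y z :: "'a::complex_inner"
  shows "cinner (x - y) z = cinner x z - cinner y z"
  using cinner_add_left[of x "- y" z] by (simp add: cinner_minus_left)

lemmas cinner_simps = cinner_add_left cinner_add_right cinner_diff_left cinner_diff_right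
  cinner_minus_left cinner_minus_right cinner_zero_left cinner_zero_right
  cinner_scaleC_left cinner_scaleC_right cinner_scaleR_left cinner_scaleR_right

lemma cinner_self: "cinner x x = of_real ((norm (x::'a::complex_inner))\<^sup>2)"
proof -
  have "cnj (cinner x x) = cinner x x"
    by (simp flip: cinner_commute)
  then have "Im (cinner x x) = 0"
    by (simp add: complex_eq_iff)
  then show ?thesis
    by (simp add: complex_eq_iff norm_eq_sqrt_cinner cinner_self_nonneg)
qed

lemma Re_cinner_commute: "Re (cinner x (y::'a::complex_inner)) = Re (cinner y x)"
  by (metis cinner_commute complex_cnj(1) complex.sel(1) complex_surj)

lemma norm_cinner_commute: "cmod (cinner x (y::'a::complex_inner)) = cmod (cinner y x)"
  by (metis cinner_commute complex_mod_cnj)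

lemma cinner_mult_commuted:
  "cinner x (y::'a::complex_inner) * cinner y x = of_real ((cmod (cinner x y))\<^sup>2)"
  by (metis cinner_commute complex_norm_square)

lemma norm_scaleC: "norm (c *\<^sub>C (x::'a::complex_inner)) = cmod c * norm x"
proof -
  have "complex_of_real ((norm (c *\<^sub>C x))\<^sup>2) = of_real ((cmod c)\<^sup>2) * of_real ((norm x)\<^sup>2)"
    unfolding complex_norm_square cinner_self[symmetric]
    by (simp only: cinner_scaleC_left cinner_scaleC_right mult_ac)
  then have "(norm (c *\<^sub>C x))\<^sup>2 = (cmod c * norm x)\<^sup>2"
    by (metis of_real_eq_iff of_real_mult power_mult_distrib)
  then show ?thesis
    by simp
qed

lemma norm_add_square:
  "(norm (x + y::'a::complex_inner))\<^sup>2 = (norm x)\<^sup>2 + (norm y)\<^sup>2 + 2 * Re (cinner x y)"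
proof -
  have "Re (cinner (x + y) (x + y)) = (norm x)\<^sup>2 + (norm y)\<^sup>2 + 2 * Re (cinner x y)"
    using Re_cinner_commute[of x y]
    by (simp only: cinner_simps) (simp add: cinner_self)
  then show ?thesis
    by (simp add: cinner_self)
qed

lemma norm_diff_square:
  "(norm (x - y::'a::complex_inner))\<^sup>2 = (norm x)\<^sup>2 + (norm y)\<^sup>2 - 2 * Re (cinner x y)"
  using norm_add_square[of x "- y"] by (simp add: cinner_simps)

text \<open>Pythagoras' theorem. The left-hand side is nonnegative, which gives the Cauchy-Schwarz and Bessel
  inequalities, and it vanishes in the case of equality in Cauchy-Schwarz, which shows later on that
  the constructed isometry is surjective.\<close>

lemma norm_diff_component_square:
  assumes "norm (u::'a::complex_inner) = 1"
  shows "(norm (x - cinner x u *\<^sub>C u))\<^sup>2 = (norm x)\<^sup>2 - (cmod (cinner x u))\<^sup>2"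
proof -
  have "Re (cinner x (cinner x u *\<^sub>C u)) = (cmod (cinner x u))\<^sup>2"
    unfolding cmod_power2 by (simp add: cinner_scaleC_right power2_eq_square)
  then show ?thesis
    using assms by (simp add: norm_diff_square norm_scaleC)
qed

lemma cinner_Cauchy_Schwarz: "cmod (cinner x (y::'a::complex_inner)) \<le> norm x * norm y"
proof (cases "y = 0")
  case False
  define u where "u = (1 / norm y) *\<^sub>R y"
  have u: "norm u = 1" and y: "y = norm y *\<^sub>R u"
    using False by (simp_all add: u_def)
  have "(cmod (cinner x u))\<^sup>2 \<le> (norm x)\<^sup>2"
    using norm_diff_component_square[OF u, of x] zero_le_power2[of "norm (x - cinner x u *\<^sub>C u)"]
    by linarith
  then have "cmod (cinner x u) \<le> norm x"
    by (simp add: power2_le_iff_abs_le)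
  moreover have "cmod (cinner x y) = norm y * cmod (cinner x u)"
    by (subst y) (simp add: cinner_simps norm_mult)
  ultimately show ?thesis
    by (metis mult.commute mult_left_mono norm_ge_zero)
qed (simp add: cinner_simps)

lemma Bessel_two:
  assumes "norm (u::'a::complex_inner) = 1" "norm w = 1" "cinner w u = 0"
  shows "(cmod (cinner x u))\<^sup>2 + (cmod (cinner x w))\<^sup>2 \<le> (norm x)\<^sup>2"
proof -
  have "cmod (cinner (x - cinner x u *\<^sub>C u) w) \<le> norm (x - cinner x u *\<^sub>C u)"
    using cinner_Cauchy_Schwarz[of _ w] assms(2) by fastforce
  moreover have "cinner u w = 0"
    using assms(3) cinner_commute[of u w] by simp
  ultimately have "(cmod (cinner x w))\<^sup>2 \<le> (norm (x - cinner x u *\<^sub>C u))\<^sup>2"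
    by (simp add: cinner_simps power_mono)
  then show ?thesis
    using norm_diff_component_square[OF assms(1), of x] by linarith
qed

section \<open>Quadratic forms of self-adjoint operators\<close>

lemma bounded_operator_scaleC: "A \<in> bounded_operators \<Longrightarrow> A (c *\<^sub>C x) = c *\<^sub>C A x"
  unfolding bounded_operators_def by (simp add: Vector_Spaces.linear_iff)

lemma bounded_operatorsI:
  assumes "\<And>c x. blinfun_apply A (c *\<^sub>C x) = c *\<^sub>C A x"
  shows "A \<in> bounded_operators"
  unfolding bounded_operators_def
  by (simp add: Vector_Spaces.linear_iff blinfun.add_right assms vector_space_scaleC)

lemma selfadjoint_cinner: "selfadjoint A \<Longrightarrow> cinner (A x) y = cinner x (A y)"
  by (simp add: selfadjoint_def)

lemma selfadjoint_scaleC: "selfadjoint A \<Longrightarrow> A (c *\<^sub>C x) = c *\<^sub>C A x"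
  by (simp add: selfadjoint_def bounded_operator_scaleC)

lemma selfadjointI:
  assumes "\<And>c x. blinfun_apply A (c *\<^sub>C x) = c *\<^sub>C A x" "\<And>x y. cinner (A x) y = cinner x (A y)"
  shows "selfadjoint A"
  by (simp add: selfadjoint_def assms bounded_operatorsI)

lemma scaleR_scaleC_commute: "r *\<^sub>R (c *\<^sub>C x) = c *\<^sub>C (r *\<^sub>R (x::'a::complex_inner))"
  by (simp add: scaleR_scaleC scaleC_scaleC mult.commute)

lemma scaleC_diff_right: "c *\<^sub>C (x - y) = c *\<^sub>C x - c *\<^sub>C (y::'a::complex_inner)"
  by (metis add_diff_cancel_right' diff_add_cancel scaleC_add_right)

lemma selfadjoint_add: "selfadjoint A \<Longrightarrow> selfadjoint B \<Longrightarrow> selfadjoint (A + B)"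
  by (rule selfadjointI)
    (simp_all add: blinfun.add_left selfadjoint_scaleC scaleC_add_right cinner_simps selfadjoint_cinner)

lemma selfadjoint_scaleR: "selfadjoint A \<Longrightarrow> selfadjoint (r *\<^sub>R A)"
  by (rule selfadjointI)
    (simp_all add: blinfun.scaleR_left selfadjoint_scaleC scaleR_scaleC_commute cinner_simps
      selfadjoint_cinner)

lemma selfadjoint_diff: "selfadjoint A \<Longrightarrow> selfadjoint B \<Longrightarrow> selfadjoint (A - B)"
  using selfadjoint_add[of A "(-1) *\<^sub>R B"] selfadjoint_scaleR[of B "-1"] by simp

lemma selfadjoint_id: "selfadjoint id_blinfun"
  by (rule selfadjointI) simp_all

lemma selfadjoint_zero: "selfadjoint 0"
  using selfadjoint_scaleR[OF selfadjoint_id, of 0] by simp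

lemmas selfadjoint_intros = selfadjoint_add selfadjoint_scaleR selfadjoint_diff selfadjoint_id
  selfadjoint_zero

definition qform :: "('a::complex_inner \<Rightarrow>\<^sub>L 'a) \<Rightarrow> 'a \<Rightarrow> real"
  where "qform A x = Re (cinner (A x) x)"

lemma qform_add: "qform (A + B) x = qform A x + qform B x"
  by (simp add: qform_def blinfun.add_left cinner_simps)

lemma qform_diff: "qform (A - B) x = qform A x - qform B x"
  by (simp add: qform_def blinfun.diff_left cinner_simps)

lemma qform_scaleR: "qform (r *\<^sub>R A) x = r * qform A x"
  by (simp add: qform_def blinfun.scaleR_left cinner_simps)

lemma qform_zero: "qform 0 x = 0"
  by (simp add: qform_def cinner_simps)

lemma qform_id: "qform id_blinfun x = (norm x)\<^sup>2"
  by (simp add: qform_def cinner_self)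

lemmas qform_simps = qform_add qform_diff qform_scaleR qform_zero qform_id

lemma qform_scaleC_arg: "selfadjoint A \<Longrightarrow> qform A (c *\<^sub>C x) = (cmod c)\<^sup>2 * qform A x"
  by (simp add: qform_def selfadjoint_scaleC cinner_scaleC_left cinner_scaleC_right cmod_power2)
    (simp add: power2_eq_square algebra_simps)

lemma qform_scaleR_arg: "qform A (r *\<^sub>R x) = r\<^sup>2 * qform A x"
  by (simp add: qform_def blinfun.scaleR_right cinner_simps power2_eq_square)

lemma qform_add_arg:
  assumes "selfadjoint A"
  shows "qform A (x + y) = qform A x + qform A y + 2 * Re (cinner (A x) y)"
  using Re_cinner_commute[of "A y" x]
  by (simp add: qform_def blinfun.add_right cinner_simps selfadjoint_cinner[OF assms, of x y])

lemma selfadjoint_eqI: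
  assumes "selfadjoint A" "selfadjoint B" "\<And>x. qform A x = qform B x"
  shows "A = B"
proof (rule blinfun_eqI)
  fix x
  let ?y = "A x - B x"
  have "Re (cinner (A x) ?y) = Re (cinner (B x) ?y)"
    using qform_add_arg[OF assms(1), of x ?y] qform_add_arg[OF assms(2), of x ?y] assms(3) by simp
  then have "Re (cinner ?y ?y) = 0"
    by (simp add: cinner_diff_left)
  then show "A x = B x"
    by (simp add: cinner_self)
qed

lemma qform_bound: "\<bar>qform A x\<bar> \<le> norm A * (norm x)\<^sup>2"
proof -
  have "\<bar>qform A x\<bar> \<le> cmod (cinner (A x) x)"
    by (simp add: qform_def abs_Re_le_cmod)
  also have "\<dots> \<le> norm (A x) * norm x"
    by (rule cinner_Cauchy_Schwarz)
  also have "\<dots> \<le> norm A * norm x * norm x"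
    by (intro mult_right_mono norm_blinfun) simp
  finally show ?thesis
    by (simp add: power2_eq_square mult.assoc)
qed

section \<open>Effects and projections\<close>

lemma effects_iff: "A \<in> effects \<longleftrightarrow> selfadjoint A \<and> (\<forall>x. 0 \<le> qform A x \<and> qform A x \<le> (norm x)\<^sup>2)"
  unfolding effects_def op_le_def
  by (auto simp: selfadjoint_zero selfadjoint_id cinner_simps qform_def cinner_self)
    (auto simp: selfadjoint_def)

lemma effects_selfadjoint: "A \<in> effects \<Longrightarrow> selfadjoint A"
  by (simp add: effects_iff)

lemma zero_effect: "0 \<in> effects"
  by (simp add: effects_iff selfadjoint_intros qform_simps)

lemma id_effect: "id_blinfun \<in> effects"
  by (simp add: effects_iff selfadjoint_intros qform_simps)

lemma complement_effect: "A \<in> effects \<Longrightarrow> id_blinfun - A \<in> effects"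
  by (simp add: effects_iff selfadjoint_intros qform_simps)

lemma convex_effects: "convex effects"
  unfolding convex_def
proof (intro ballI allI impI)
  fix A B :: "'a \<Rightarrow>\<^sub>L 'a" and u v :: real
  assume AB: "A \<in> effects" "B \<in> effects" and uv: "0 \<le> u" "0 \<le> v" "u + v = 1"
  have "u * qform A x + v * qform B x \<le> (norm x)\<^sup>2" for x
    using AB uv convex_bound_le[of "qform A x" "(norm x)\<^sup>2" "qform B x" u v]
    by (simp add: effects_iff)
  then show "u *\<^sub>R A + v *\<^sub>R B \<in> effects"
    using AB uv by (simp add: effects_iff selfadjoint_intros qform_simps)
qed

lemma half_effect: "(1/2) *\<^sub>R id_blinfun \<in> effects"
  by (simp add: effects_iff selfadjoint_intros qform_simps)

lemma half_add_effect_iff: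
  assumes "selfadjoint A"
  shows "(1/2) *\<^sub>R id_blinfun + t *\<^sub>R A \<in> effects \<longleftrightarrow> (\<forall>x. \<bar>t * qform A x\<bar> \<le> (norm x)\<^sup>2 / 2)"
proof -
  have "0 \<le> n / 2 + s \<and> n / 2 + s \<le> n \<longleftrightarrow> \<bar>s\<bar> \<le> n / 2" for n s :: real
    by linarith
  then show ?thesis
    using assms by (simp add: effects_iff selfadjoint_intros qform_simps)
qed

lemma half_add_small_effect:
  assumes "selfadjoint A" "\<bar>t\<bar> * norm A \<le> 1/2"
  shows "(1/2) *\<^sub>R id_blinfun + t *\<^sub>R A \<in> effects"
  unfolding half_add_effect_iff[OF assms(1)]
proof
  fix x
  have "\<bar>t * qform A x\<bar> \<le> \<bar>t\<bar> * (norm A * (norm x)\<^sup>2)"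
    by (simp add: abs_mult mult_left_mono qform_bound)
  also have "\<dots> \<le> (1/2) * (norm x)\<^sup>2"
    using mult_right_mono[OF assms(2), of "(norm x)\<^sup>2"] by (simp add: mult.assoc)
  finally show "\<bar>t * qform A x\<bar> \<le> (norm x)\<^sup>2 / 2"
    by simp
qed

text \<open>This is \<open>A\<^sup>2 \<le> A\<close>, obtained without square roots or spectral theory by evaluating the form of
  \<open>A\<close> at \<open>x - A x\<close>. In particular an effect annihilates every vector at which its form vanishes.\<close>

lemma effect_norm_square_le:
  assumes "A \<in> effects"
  shows "(norm (A x))\<^sup>2 \<le> qform A x"
proof -
  have sa: "selfadjoint A"
    using assms by (rule effects_selfadjoint)
  have "0 \<le> qform A (x + (-1) *\<^sub>R A x)" and "qform A (A x) \<le> (norm (A x))\<^sup>2"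
    using assms by (auto simp: effects_iff)
  moreover have "qform A (x + (-1) *\<^sub>R A x) = qform A x + qform A (A x) - 2 * (norm (A x))\<^sup>2"
    unfolding qform_add_arg[OF sa] qform_scaleR_arg by (simp add: cinner_simps cinner_self)
  ultimately show ?thesis
    by linarith
qed

lemma effect_eq_zero:
  assumes "A \<in> effects" "qform A x \<le> 0"
  shows "A x = 0"
proof -
  have "(norm (A x))\<^sup>2 \<le> 0"
    using effect_norm_square_le[OF assms(1), of x] assms(2) by linarith
  then show ?thesis
    by simp
qed

definition projection :: "('a::complex_inner \<Rightarrow>\<^sub>L 'a) \<Rightarrow> bool"
  where "projection P \<longleftrightarrow> selfadjoint P \<and> (\<forall>x. P (P x) = P x)"

lemma projection_qform:
  assumes "projection P"
  shows "qform P x = (norm (P x))\<^sup>2"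
proof -
  have "cinner (P x) x = cinner (P x) (P x)"
    using assms unfolding projection_def by (metis selfadjoint_cinner)
  then show ?thesis
    by (simp add: qform_def cinner_self)
qed

lemma projection_effect:
  assumes "projection P"
  shows "P \<in> effects"
proof -
  have "qform P x \<le> (norm x)\<^sup>2" for x
  proof -
    have "(norm (x - P x))\<^sup>2 = (norm x)\<^sup>2 - qform P x"
      using projection_qform[OF assms, of x] Re_cinner_commute[of x "P x"]
      by (simp add: norm_diff_square qform_def)
    then show ?thesis
      using zero_le_power2[of "norm (x - P x)"] by linarith
  qed
  then show ?thesis
    using assms projection_qform[OF assms] by (simp add: effects_iff projection_def)
qed

text \<open>Midpoints are enough: a segment with \<open>E\<close> in its interior contains one with midpoint \<open>E\<close>.\<close>

definition extreme_effect :: "('a::complex_inner \<Rightarrow>\<^sub>L 'a) \<Rightarrow> bool"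
  where "extreme_effect E \<longleftrightarrow> E \<in> effects \<and>
    (\<forall>X\<in>effects. \<forall>Y\<in>effects. E = (1/2) *\<^sub>R X + (1/2) *\<^sub>R Y \<longrightarrow> X = E)"

lemma selfadjoint_square: "selfadjoint A \<Longrightarrow> selfadjoint (A o\<^sub>L A)"
  by (rule selfadjointI) (simp_all add: selfadjoint_scaleC selfadjoint_cinner)

lemma qform_square: "selfadjoint A \<Longrightarrow> qform (A o\<^sub>L A) x = (norm (A x))\<^sup>2"
  by (simp add: qform_def selfadjoint_cinner cinner_self)

lemma square_effect:
  assumes "A \<in> effects"
  shows "A o\<^sub>L A \<in> effects"
proof -
  have "(norm (A x))\<^sup>2 \<le> (norm x)\<^sup>2" for x
    using effect_norm_square_le[OF assms, of x] assms by (meson effects_iff order_trans)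
  then show ?thesis
    using effects_selfadjoint[OF assms] by (simp add: effects_iff selfadjoint_square qform_square)
qed

text \<open>An effect \<open>E\<close> is the midpoint of the effects \<open>E\<^sup>2\<close> and \<open>I - (I - E)\<^sup>2\<close>, so it can only be
  extreme if \<open>E = E\<^sup>2\<close>. Conversely, a midpoint of effects which vanishes (or equals \<open>I\<close>) on a vector
  forces both of them to do the same there.\<close>

lemma extreme_effect_iff: "extreme_effect E \<longleftrightarrow> projection E"
proof
  assume E: "extreme_effect E"
  then have eff: "E \<in> effects"
    by (simp add: extreme_effect_def)
  let ?I = "id_blinfun :: 'a \<Rightarrow>\<^sub>L 'a"
  let ?Y = "?I - ((?I - E) o\<^sub>L (?I - E))"
  have "E o\<^sub>L E \<in> effects" "?Y \<in> effects"
    by (simp_all add: eff square_effect complement_effect)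
  moreover have "E = (1/2) *\<^sub>R (E o\<^sub>L E) + (1/2) *\<^sub>R ?Y"
  proof (rule blinfun_eqI)
    fix x
    have "2 *\<^sub>R E x = E (E x) + ?Y x"
      by (simp add: blinfun.bilinear_simps scaleR_2)
    then have "E x = (1/2) *\<^sub>R (E (E x) + ?Y x)"
      by (metis (no_types) field_sum_of_halves mult_1 scaleR_2 scaleR_half_double scaleR_add_right)
    then show "E x = ((1/2) *\<^sub>R (E o\<^sub>L E) + (1/2) *\<^sub>R ?Y) x"
      by (simp add: blinfun.add_left blinfun.scaleR_left scaleR_add_right)
  qed
  ultimately have "E o\<^sub>L E = E"
    using E unfolding extreme_effect_def by blast
  then have "E (E x) = E x" for x
    by (metis blinfun_apply_blinfun_compose)
  then show "projection E"
    using effects_selfadjoint[OF eff] by (simp add: projection_def)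
next
  assume P: "projection E"
  show "extreme_effect E"
    unfolding extreme_effect_def
  proof (intro conjI ballI impI)
    fix X Y assume XY: "X \<in> effects" "Y \<in> effects" and E: "E = (1/2) *\<^sub>R X + (1/2) *\<^sub>R Y"
    have q: "qform E z = qform X z / 2 + qform Y z / 2" for z
      by (simp add: E qform_simps)
    show "X = E"
    proof (rule blinfun_eqI)
      fix x
      let ?k = "x - E x" and ?r = "E x"
      have k: "E ?k = 0" and r: "E ?r = ?r"
        using P by (simp_all add: projection_def blinfun.diff_right)
      have "qform E ?k = 0" "qform (id_blinfun - E) ?r = 0"
        by (simp_all add: qform_diff qform_id) (simp_all add: qform_def k r cinner_simps cinner_self)
      moreover have "0 \<le> qform Y ?k" "qform Y ?r \<le> (norm ?r)\<^sup>2"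
        using XY by (auto simp: effects_iff)
      ultimately have "qform X ?k \<le> 0" "qform (id_blinfun - X) ?r \<le> 0"
        by (simp_all add: q qform_diff qform_id)
      then have "X ?k = 0" "(id_blinfun - X) ?r = 0"
        using XY by (auto intro: effect_eq_zero complement_effect)
      then have "X x = X (E x)" "X (E x) = E x"
        by (simp_all add: blinfun.diff_left blinfun.diff_right)
      then show "X x = E x"
        by simp
    qed
  qed (rule projection_effect[OF P])
qed


section \<open>Operators of rank one\<close>

definition rank1 :: "'a::complex_inner \<Rightarrow> 'a \<Rightarrow>\<^sub>L 'a"
  where "rank1 x = Blinfun (\<lambda>y. cinner y x *\<^sub>C x)"

lemma rank1_apply: "rank1 x y = cinner y x *\<^sub>C x"
proof -
  have "bounded_linear (\<lambda>y. cinner y x *\<^sub>C x)"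
  proof (rule bounded_linear_intro)
    fix y z :: 'a and r :: real
    show "cinner (y + z) x *\<^sub>C x = cinner y x *\<^sub>C x + cinner z x *\<^sub>C x"
      by (simp add: cinner_simps scaleC_add_left)
    show "cinner (r *\<^sub>R y) x *\<^sub>C x = r *\<^sub>R (cinner y x *\<^sub>C x)"
      by (simp add: cinner_simps scaleR_scaleC scaleC_scaleC)
    show "norm (cinner y x *\<^sub>C x) \<le> norm y * (norm x * norm x)"
      using mult_right_mono[OF cinner_Cauchy_Schwarz[of y x], of "norm x"]
      by (simp add: norm_scaleC mult.assoc)
  qed
  then show ?thesis
    by (simp add: rank1_def bounded_linear_Blinfun_apply)
qed

lemma selfadjoint_rank1: "selfadjoint (rank1 x)"
proof (rule selfadjointI)
  fix y z
  show "cinner (rank1 x y) z = cinner y (rank1 x z)"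
    by (simp add: rank1_apply cinner_simps mult.commute flip: cinner_commute)
qed (simp add: rank1_apply cinner_simps scaleC_scaleC)

lemma qform_rank1: "qform (rank1 x) y = (cmod (cinner y x))\<^sup>2"
  using cinner_mult_commuted[of y x] by (simp add: qform_def rank1_apply cinner_simps)

lemma scaleC_zero_left: "0 *\<^sub>C (x::'a::complex_inner) = 0"
  using scaleR_scaleC[of 0 x] by simp

lemma scaleC_zero_right: "c *\<^sub>C (0::'a::complex_inner) = 0"
  using scaleC_diff_right[of c 0 0] by simp

lemma rank1_scaleC: "rank1 (c *\<^sub>C x) = (cmod c)\<^sup>2 *\<^sub>R rank1 x"
  by (rule selfadjoint_eqI)
    (simp_all add: selfadjoint_rank1 selfadjoint_scaleR qform_scaleR qform_rank1 cinner_simps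
      norm_mult power_mult_distrib)

lemma rank1_scaleR: "rank1 (r *\<^sub>R x) = r\<^sup>2 *\<^sub>R rank1 x"
  by (simp add: scaleR_scaleC rank1_scaleC flip: of_real_power)

lemma rank1_zero: "rank1 0 = 0"
  using rank1_scaleR[of 0 0] by simp

lemma rank1_self_apply: "rank1 x x = (norm x)\<^sup>2 *\<^sub>R x"
  by (simp add: rank1_apply cinner_self scaleR_scaleC)

lemma projection_rank1: "norm x = 1 \<Longrightarrow> projection (rank1 x)"
  by (simp add: projection_def selfadjoint_rank1 rank1_apply cinner_simps cinner_self)

lemma rank1_eqD:
  assumes "rank1 u = rank1 (v::'a::complex_inner)"
  obtains c where "cmod c = 1" "u = c *\<^sub>C v"
proof (cases "u = 0")
  case True
  then have "(norm v)\<^sup>2 *\<^sub>R v = 0"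
    using assms rank1_self_apply[of v] by (simp add: rank1_zero flip: assms)
  then have "v = 0"
    by auto
  then show ?thesis
    using True that[of 1] by (simp add: scaleC_one)
next
  case False
  define c where "c = of_real (1 / (norm u)\<^sup>2) * cinner u v"
  have "(norm u)\<^sup>2 *\<^sub>R u = cinner u v *\<^sub>C v"
    using rank1_self_apply[of u] assms by (simp add: rank1_apply)
  then have "(1 / (norm u)\<^sup>2) *\<^sub>R ((norm u)\<^sup>2 *\<^sub>R u) = (1 / (norm u)\<^sup>2) *\<^sub>R (cinner u v *\<^sub>C v)"
    by simp
  then have u: "u = c *\<^sub>C v"
    using False by (simp add: c_def scaleR_scaleC[of _ "_ *\<^sub>C v"] scaleC_scaleC)
  have "(cmod c)\<^sup>2 *\<^sub>R rank1 v = rank1 v"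
    using assms by (simp add: u rank1_scaleC)
  then have "((cmod c)\<^sup>2 - 1) *\<^sub>R (rank1 v v) = 0"
    by (metis blinfun.scaleR_left cancel_comm_monoid_add_class.diff_cancel scaleR_left_diff_distrib
        scaleR_one)
  moreover have "v \<noteq> 0"
    using False by (auto simp: u scaleC_zero_right)
  ultimately have "(cmod c)\<^sup>2 = 1"
    by (simp add: rank1_self_apply)
  then have "cmod c = 1"
    by (simp add: power2_eq_1_iff) (use norm_ge_zero[of c] in linarith)
  then show ?thesis
    using that u by blast
qed

lemma projection_minus_rank1:
  assumes "projection P" "P u = u" "norm u = 1"
  shows "projection (P - rank1 u)"
proof -
  have "cinner (P x) u = cinner x u" for x
    using assms(1,2) unfolding projection_def by (metis selfadjoint_cinner)
  then show ?thesis
    using assms unfolding projection_def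
    by (simp add: selfadjoint_diff selfadjoint_rank1 blinfun.diff_left blinfun.diff_right rank1_apply
        selfadjoint_scaleC cinner_simps cinner_self scaleC_one)
qed

lemma projection_plus_rank1:
  assumes "projection P" "P u = 0" "norm u = 1"
  shows "projection (P + rank1 u)"
proof -
  have "cinner (P x) u = 0" for x
    using assms(1,2) unfolding projection_def by (metis selfadjoint_cinner cinner_zero_right)
  then show ?thesis
    using assms unfolding projection_def
    by (simp add: selfadjoint_add selfadjoint_rank1 blinfun.add_left blinfun.add_right rank1_apply
        selfadjoint_scaleC cinner_simps cinner_self scaleC_one scaleC_zero_left scaleC_zero_right)
qed

text \<open>An effect below the projection onto the line of \<open>x\<close> vanishes on the orthogonal complement of
  \<open>x\<close>, and by self-adjointness its range is contained in the line.\<close>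

lemma effect_below_rank1:
  assumes E: "E \<in> effects" and x: "norm (x::'a::complex_inner) = 1"
    and le: "\<And>y. qform E y \<le> qform (rank1 x) y"
  shows "\<exists>r. E = r *\<^sub>R rank1 x"
proof -
  note sa = effects_selfadjoint[OF E]
  have perp: "E z = 0" if "cinner z x = 0" for z
    using effect_eq_zero[OF E, of z] le[of z] that by (simp add: qform_rank1)
  have split: "cinner (z - cinner z x *\<^sub>C x) x = 0" for z
    using x by (simp add: cinner_simps cinner_self)
  define z where "z = E x - cinner (E x) x *\<^sub>C x"
  have "cinner z z = cinner (E x) z - cinner (E x) x * cinner x z"
    unfolding z_def by (simp add: cinner_diff_left cinner_scaleC_left)
  moreover have "cinner x z = 0"
    using split[of "E x"] cinner_commute[of x z] by (simp add: z_def)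
  moreover have "cinner (E x) z = 0"
    using perp[of z] split[of "E x"] by (simp add: selfadjoint_cinner[OF sa] z_def cinner_zero_right)
  ultimately have "z = 0"
    by (simp add: cinner_self_eq_zero)
  moreover have "cinner (E x) x = of_real (qform E x)"
    using selfadjoint_cinner[OF sa, of x x] cinner_commute[of x "E x"]
    by (simp add: qform_def complex_eq_iff)
  ultimately have Ex: "E x = qform E x *\<^sub>R x"
    by (simp add: z_def scaleR_scaleC)
  have "E = qform E x *\<^sub>R rank1 x"
  proof (rule blinfun_eqI)
    fix y
    have "E y = E (cinner y x *\<^sub>C x)"
      using perp[OF split[of y]] by (simp add: blinfun.diff_right)
    then show "E y = (qform E x *\<^sub>R rank1 x) y"
      by (simp add: selfadjoint_scaleC[OF sa] Ex blinfun.scaleR_left rank1_apply scaleR_scaleC_commute)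
  qed
  then show ?thesis ..
qed

section \<open>Affine bijections of the set of effects\<close>

locale effect_symmetry =
  fixes \<phi> :: "('a::complex_inner \<Rightarrow>\<^sub>L 'a) \<Rightarrow> ('a \<Rightarrow>\<^sub>L 'a)"
  assumes bij: "bij_betw \<phi> effects effects"
    and affine: "affine_on effects \<phi>"
begin

abbreviation centre :: "'a \<Rightarrow>\<^sub>L 'a"
  where "centre \<equiv> (1/2) *\<^sub>R id_blinfun"

lemma effect_image: "E \<in> effects \<Longrightarrow> \<phi> E \<in> effects"
  using bij by (auto simp: bij_betw_def)

lemma selfadjoint_image: "E \<in> effects \<Longrightarrow> selfadjoint (\<phi> E)"
  by (simp add: effect_image effects_selfadjoint)

lemma effect_preimage:
  assumes "F \<in> effects"
  obtains E where "E \<in> effects" "\<phi> E = F"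
  using assms bij unfolding bij_betw_def by (metis imageE)

lemma image_eqD: "\<phi> E = \<phi> F \<Longrightarrow> E \<in> effects \<Longrightarrow> F \<in> effects \<Longrightarrow> E = F"
  using bij by (auto simp: bij_betw_def inj_on_def)

lemma affineD:
  "\<lbrakk>E \<in> effects; F \<in> effects; 0 \<le> t; t \<le> 1\<rbrakk> \<Longrightarrow>
    \<phi> (t *\<^sub>R E + (1 - t) *\<^sub>R F) = t *\<^sub>R \<phi> E + (1 - t) *\<^sub>R \<phi> F"
  using affine by (simp add: affine_on_def)

lemma midpoint_image:
  "E \<in> effects \<Longrightarrow> F \<in> effects \<Longrightarrow>
    \<phi> ((1/2) *\<^sub>R E + (1/2) *\<^sub>R F) = (1/2) *\<^sub>R \<phi> E + (1/2) *\<^sub>R \<phi> F"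
  using affineD[of E F "1/2"] by simp

lemma midpoint_effect: "E \<in> effects \<Longrightarrow> F \<in> effects \<Longrightarrow> (1/2) *\<^sub>R E + (1/2) *\<^sub>R F \<in> effects"
  using convexD[OF convex_effects, of E F "1/2" "1/2"] by simp

text \<open>The directional derivative of \<open>\<phi>\<close> at \<open>I/2\<close>. Since the set of effects is \<open>I/2\<close> plus half of
  the unit ball of the self-adjoint operators, this is defined in every self-adjoint direction
  whatever \<open>\<phi>\<close> does to \<open>0\<close>; adding \<open>1\<close> to the norm only keeps the step size finite.\<close>

definition lin :: "('a \<Rightarrow>\<^sub>L 'a) \<Rightarrow> ('a \<Rightarrow>\<^sub>L 'a)"
  where "lin A = (2 * (norm A + 1)) *\<^sub>R
    (\<phi> (centre + (1 / (2 * (norm A + 1))) *\<^sub>R A) - \<phi> centre)"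

lemma image_segment:
  assumes "E \<in> effects" "F \<in> effects" "0 \<le> r" "r \<le> 1"
  shows "\<phi> (E + r *\<^sub>R (F - E)) = \<phi> E + r *\<^sub>R (\<phi> F - \<phi> E)"
  using affineD[OF assms(2,1,3,4)] by (simp add: algebra_simps)

text \<open>For positive \<open>t\<close> the shorter of the step \<open>t\<close> and the step in the definition of \<open>lin\<close> ends on the
  segment from \<open>I/2\<close> to the end of the longer one. Negative \<open>t\<close> are obtained by reflection in \<open>I/2\<close>.\<close>

lemma image_centre_add:
  assumes A: "selfadjoint A" and t: "centre + t *\<^sub>R A \<in> effects"
  shows "\<phi> (centre + t *\<^sub>R A) = \<phi> centre + t *\<^sub>R lin A"
proof -
  define s where "s = 1 / (2 * (norm A + 1))"
  have s: "0 < s"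
    by (simp add: s_def add_nonneg_pos)
  have small: "\<bar>s\<bar> * norm A \<le> 1/2"
    using s by (simp add: s_def field_simps add_nonneg_pos)
  have lin: "\<phi> (centre + s *\<^sub>R A) = \<phi> centre + s *\<^sub>R lin A"
  proof -
    have "lin A = (1 / s) *\<^sub>R (\<phi> (centre + s *\<^sub>R A) - \<phi> centre)"
      by (simp add: lin_def s_def)
    then show ?thesis
      using s by simp
  qed
  have pos: "\<phi> (centre + t *\<^sub>R A) = \<phi> centre + t *\<^sub>R lin A"
    if t: "0 < t" "centre + t *\<^sub>R A \<in> effects" for t
  proof (cases "t \<le> s")
    case True
    then show ?thesis
      using image_segment[OF half_effect half_add_small_effect[OF A small], of "t / s"] lin s t
      by simp
  next
    case False
    then have "\<phi> (centre + s *\<^sub>R A) = \<phi> centre + (s / t) *\<^sub>R (\<phi> (centre + t *\<^sub>R A) - \<phi> centre)"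
      using image_segment[OF half_effect t(2), of "s / t"] s t by simp
    then have "(t / s) *\<^sub>R (s *\<^sub>R lin A) =
        (t / s) *\<^sub>R ((s / t) *\<^sub>R (\<phi> (centre + t *\<^sub>R A) - \<phi> centre))"
      using lin by simp
    then show ?thesis
      using s t by (simp add: algebra_simps)
  qed
  consider "t > 0" | "t = 0" | "t < 0"
    by linarith
  then show ?thesis
  proof cases
    case 3
    have mirrored: "centre + (- t) *\<^sub>R A \<in> effects"
      using t unfolding half_add_effect_iff[OF A] by simp
    have "centre = (1/2) *\<^sub>R (centre + t *\<^sub>R A) + (1/2) *\<^sub>R (centre + (- t) *\<^sub>R A)"
      by (simp add: algebra_simps flip: scaleR_add_left)
    then have "\<phi> centre = (1/2) *\<^sub>R \<phi> (centre + t *\<^sub>R A) + (1/2) *\<^sub>R \<phi> (centre + (- t) *\<^sub>R A)"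
      using midpoint_image[OF t mirrored] by simp
    also have "\<phi> (centre + (- t) *\<^sub>R A) = \<phi> centre + (- t) *\<^sub>R lin A"
      using 3 mirrored by (intro pos) simp_all
    finally have "2 *\<^sub>R \<phi> centre =
        2 *\<^sub>R ((1/2) *\<^sub>R \<phi> (centre + t *\<^sub>R A) + (1/2) *\<^sub>R (\<phi> centre + (- t) *\<^sub>R lin A))"
      by simp
    then have "2 *\<^sub>R \<phi> centre = \<phi> (centre + t *\<^sub>R A) + (\<phi> centre - t *\<^sub>R lin A)"
      by (simp only: scaleR_add_right) simp
    then show ?thesis
      by (simp add: scaleR_2 algebra_simps)
  qed (use pos t in simp_all)
qed

lemma small_step:
  assumes "selfadjoint A"
  shows "\<exists>\<delta>>0. \<forall>t. \<bar>t\<bar> \<le> \<delta> \<longrightarrow> centre + t *\<^sub>R A \<in> effects"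
proof (intro exI conjI allI impI)
  show "0 < 1 / (2 * (norm A + 1))"
    by (simp add: add_nonneg_pos)
  fix t assume t: "\<bar>t\<bar> \<le> 1 / (2 * (norm A + 1))"
  have "\<bar>t\<bar> * norm A \<le> \<bar>t\<bar> * (norm A + 1)"
    by (simp add: mult_left_mono)
  also have "\<dots> \<le> 1 / (2 * (norm A + 1)) * (norm A + 1)"
    using t by (rule mult_right_mono) simp
  also have "\<dots> = 1/2"
    using norm_ge_zero[of A] by (simp add: add_nonneg_eq_0_iff)
  finally show "centre + t *\<^sub>R A \<in> effects"
    by (rule half_add_small_effect[OF assms])
qed

lemma lin_scaleR:
  assumes A: "selfadjoint A"
  shows "lin (r *\<^sub>R A) = r *\<^sub>R lin A"
proof -
  have rA: "selfadjoint (r *\<^sub>R A)"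
    by (rule selfadjoint_scaleR[OF A])
  obtain t where t: "t > 0" "\<And>s. \<bar>s\<bar> \<le> t \<Longrightarrow> centre + s *\<^sub>R (r *\<^sub>R A) \<in> effects"
    using small_step[OF rA] by blast
  have "centre + t *\<^sub>R (r *\<^sub>R A) \<in> effects" "centre + (t * r) *\<^sub>R A \<in> effects"
    using t(1) t(2)[of t] by simp_all
  then have "t *\<^sub>R lin (r *\<^sub>R A) = (t * r) *\<^sub>R lin A"
    using image_centre_add[OF rA, of t] image_centre_add[OF A, of "t * r"] by simp
  then have "(1 / t) *\<^sub>R (t *\<^sub>R lin (r *\<^sub>R A)) = (1 / t) *\<^sub>R ((t * r) *\<^sub>R lin A)"
    by simp
  then show ?thesis
    using t(1) by simp
qed

lemma lin_add:
  assumes A: "selfadjoint A" and B: "selfadjoint B"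
  shows "lin (A + B) = lin A + lin B"
proof -
  have AB: "selfadjoint (A + B)"
    by (rule selfadjoint_add[OF A B])
  obtain r where r: "r > 0" "\<And>s. \<bar>s\<bar> \<le> r \<Longrightarrow> centre + s *\<^sub>R A \<in> effects"
    using small_step[OF A] by blast
  obtain r' where r': "r' > 0" "\<And>s. \<bar>s\<bar> \<le> r' \<Longrightarrow> centre + s *\<^sub>R B \<in> effects"
    using small_step[OF B] by blast
  define t where "t = min r r' / 2"
  have t: "t > 0" and eff: "centre + (2 * t) *\<^sub>R A \<in> effects" "centre + (2 * t) *\<^sub>R B \<in> effects"
    using r r' by (auto simp: t_def intro!: r(2) r'(2))
  have mid: "centre + t *\<^sub>R (A + B) =
      (1/2) *\<^sub>R (centre + (2 * t) *\<^sub>R A) + (1/2) *\<^sub>R (centre + (2 * t) *\<^sub>R B)"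
    by (simp add: scaleR_add_right flip: scaleR_add_left)
  have "centre + t *\<^sub>R (A + B) \<in> effects"
    unfolding mid by (rule midpoint_effect[OF eff])
  then have "\<phi> centre + t *\<^sub>R lin (A + B) = \<phi> (centre + t *\<^sub>R (A + B))"
    using image_centre_add[OF AB] by simp
  also have "\<dots> = (1/2) *\<^sub>R \<phi> (centre + (2 * t) *\<^sub>R A) + (1/2) *\<^sub>R \<phi> (centre + (2 * t) *\<^sub>R B)"
    unfolding mid by (rule midpoint_image[OF eff])
  also have "\<dots> = \<phi> centre + t *\<^sub>R (lin A + lin B)"
    unfolding image_centre_add[OF A eff(1)] image_centre_add[OF B eff(2)]
    by (simp add: scaleR_add_right flip: scaleR_add_left)
  finally have "t *\<^sub>R lin (A + B) = t *\<^sub>R (lin A + lin B)"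
    by (simp only: add_left_cancel)
  then show ?thesis
    using t by (simp only: scaleR_cancel_left) simp
qed

lemma lin_diff: "selfadjoint A \<Longrightarrow> selfadjoint B \<Longrightarrow> lin (A - B) = lin A - lin B"
  using lin_add[of A "(-1) *\<^sub>R B"] lin_scaleR[of B "-1"] selfadjoint_scaleR[of B "-1"] by simp

lemma selfadjoint_lin: "selfadjoint A \<Longrightarrow> selfadjoint (lin A)"
proof -
  assume A: "selfadjoint A"
  obtain t where t: "t > 0" "centre + t *\<^sub>R A \<in> effects"
    using small_step[OF A] by (metis abs_of_pos order_refl)
  have "t *\<^sub>R lin A = \<phi> (centre + t *\<^sub>R A) - \<phi> centre"
    using image_centre_add[OF A t(2)] by simp
  then have "lin A = (1 / t) *\<^sub>R (\<phi> (centre + t *\<^sub>R A) - \<phi> centre)"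
    using t(1) by (metis divide_self_if less_irrefl scaleR_one scaleR_scaleR times_divide_eq_left mult_1)
  then show ?thesis
    using selfadjoint_image[OF t(2)] selfadjoint_image[OF half_effect]
    by (simp only: selfadjoint_scaleR selfadjoint_diff)
qed

lemma image_diff:
  assumes "E \<in> effects" "F \<in> effects"
  shows "\<phi> E - \<phi> F = lin (E - F)"
proof -
  have *: "\<phi> E = \<phi> centre + lin (E - centre)" if "E \<in> effects" for E
    using image_centre_add[of "E - centre" 1] that
    by (simp add: selfadjoint_intros effects_selfadjoint)
  have "lin (E - F) = lin ((E - centre) - (F - centre))"
    by simp
  also have "\<dots> = lin (E - centre) - lin (F - centre)"
    by (rule lin_diff) (simp_all add: selfadjoint_intros effects_selfadjoint assms)
  finally show ?thesis
    using *[OF assms(1)] *[OF assms(2)] by simp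
qed

text \<open>Only one point is a centre of symmetry of the set of effects: if \<open>E \<mapsto> 2D - E\<close> maps it into
  itself then \<open>2D\<close> and \<open>2D - I\<close> are effects, whence \<open>2D = I\<close>.\<close>

lemma image_centre: "\<phi> centre = centre"
proof -
  let ?D = "2 *\<^sub>R \<phi> centre"
  have refl: "?D - F \<in> effects" if F: "F \<in> effects" for F
  proof -
    obtain E where E: "E \<in> effects" "\<phi> E = F"
      using F by (rule effect_preimage)
    have "centre = (1/2) *\<^sub>R E + (1/2) *\<^sub>R (id_blinfun - E)"
      by (simp add: scaleR_diff_right)
    then have "\<phi> centre = (1/2) *\<^sub>R F + (1/2) *\<^sub>R \<phi> (id_blinfun - E)"
      using midpoint_image[OF E(1) complement_effect[OF E(1)]] E(2) by simp
    then have "?D = F + \<phi> (id_blinfun - E)"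
      by (simp add: scaleR_add_right)
    then show ?thesis
      using effect_image[OF complement_effect[OF E(1)]] by simp
  qed
  have eff: "?D \<in> effects" "?D - id_blinfun \<in> effects"
    using refl[OF zero_effect] refl[OF id_effect] by simp_all
  have "?D = id_blinfun"
  proof (rule selfadjoint_eqI)
    fix x
    have "qform ?D x \<le> (norm x)\<^sup>2" "0 \<le> qform (?D - id_blinfun) x"
      using eff unfolding effects_iff by blast+
    then show "qform ?D x = qform id_blinfun x"
      by (simp add: qform_diff qform_id)
  qed (simp_all add: selfadjoint_id effects_selfadjoint[OF eff(1)])
  then have "(1/2) *\<^sub>R ?D = centre"
    by simp
  then show ?thesis
    by simp
qed

lemma image_complement:
  assumes "E \<in> effects"
  shows "\<phi> (id_blinfun - E) = id_blinfun - \<phi> E"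
proof -
  have "centre = (1/2) *\<^sub>R E + (1/2) *\<^sub>R (id_blinfun - E)"
    by (simp add: scaleR_diff_right)
  then have "2 *\<^sub>R centre = 2 *\<^sub>R ((1/2) *\<^sub>R \<phi> E + (1/2) *\<^sub>R \<phi> (id_blinfun - E))"
    using midpoint_image[OF assms complement_effect[OF assms]] image_centre by simp
  then show ?thesis
    by (simp add: scaleR_add_right algebra_simps)
qed

lemma projection_image_iff:
  assumes E: "E \<in> effects"
  shows "projection (\<phi> E) \<longleftrightarrow> projection E"
  unfolding extreme_effect_iff[symmetric]
proof
  assume ext: "extreme_effect (\<phi> E)"
  show "extreme_effect E"
    unfolding extreme_effect_def
  proof (intro conjI ballI impI)
    fix X Y assume XY: "X \<in> effects" "Y \<in> effects" and "E = (1/2) *\<^sub>R X + (1/2) *\<^sub>R Y"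
    then have "\<phi> E = (1/2) *\<^sub>R \<phi> X + (1/2) *\<^sub>R \<phi> Y"
      by (simp add: midpoint_image)
    then have "\<phi> X = \<phi> E"
      using ext effect_image[OF XY(1)] effect_image[OF XY(2)] unfolding extreme_effect_def by blast
    then show "X = E"
      using XY(1) E by (rule image_eqD)
  qed (rule E)
next
  assume ext: "extreme_effect E"
  show "extreme_effect (\<phi> E)"
    unfolding extreme_effect_def
  proof (intro conjI ballI impI)
    fix X Y assume "X \<in> effects" "Y \<in> effects" and eq: "\<phi> E = (1/2) *\<^sub>R X + (1/2) *\<^sub>R Y"
    then obtain X' Y' where X': "X' \<in> effects" "\<phi> X' = X" and Y': "Y' \<in> effects" "\<phi> Y' = Y"
      by (metis effect_preimage)
    have "\<phi> ((1/2) *\<^sub>R X' + (1/2) *\<^sub>R Y') = \<phi> E"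
      using midpoint_image[OF X'(1) Y'(1)] X'(2) Y'(2) eq by simp
    then have "E = (1/2) *\<^sub>R X' + (1/2) *\<^sub>R Y'"
      using image_eqD[OF _ midpoint_effect[OF X'(1) Y'(1)] E] by simp
    then have "X' = E"
      using ext X'(1) Y'(1) unfolding extreme_effect_def by metis
    then show "X = \<phi> E"
      using X'(2) by simp
  qed (rule effect_image[OF E])
qed

text \<open>What distinguishes \<open>0\<close> and \<open>I\<close> from the other projections is that they are isolated:
  every nonzero projection is at distance \<open>1\<close> from \<open>0\<close>, whereas a nontrivial projection \<open>E\<close> can be
  rotated a little, replacing a vector \<open>u\<close> of its range by a combination \<open>q\<close> of \<open>u\<close> and a vector
  \<open>w\<close> of its kernel. The distance is measured by the multiples of the difference which may be added
  to \<open>I/2\<close>. With the angle of the 3-4-5 triangle the distance is \<open>3/5\<close>, and \<open>5/6\<close> is the largest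
  admissible multiple.\<close>

lemma zero_preimage:
  assumes E: "E \<in> effects" and zero: "\<phi> E = 0"
  shows "E = 0 \<or> E = id_blinfun"
proof (rule ccontr)
  assume nontrivial: "\<not> (E = 0 \<or> E = id_blinfun)"
  have P: "projection E"
    using projection_image_iff[OF E] zero by (simp add: projection_def selfadjoint_zero)
  then have sa: "selfadjoint E" and idem: "E (E x) = E x" for x
    by (simp_all add: projection_def)
  obtain y where y: "E y \<noteq> 0"
    using nontrivial by (metis blinfun_eqI zero_blinfun.rep_eq)
  obtain y' where y': "E y' \<noteq> y'"
    using nontrivial by (metis blinfun_eqI id_blinfun.rep_eq id_apply)
  define u where "u = (1 / norm (E y)) *\<^sub>R E y"
  define w where "w = (1 / norm (y' - E y')) *\<^sub>R (y' - E y')"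
  have u: "norm u = 1" "E u = u" and w: "norm w = 1" "E w = 0"
    using y y' by (simp_all add: u_def w_def blinfun.scaleR_right blinfun.diff_right idem)
  have wu: "cinner w u = 0"
    using selfadjoint_cinner[OF sa, of w u] u w by (simp add: cinner_simps)
  then have uw: "cinner u w = 0"
    using cinner_commute[of u w] by simp
  define q where "q = (4/5) *\<^sub>R u + (3/5) *\<^sub>R w"
  have "(norm q)\<^sup>2 = 1"
    unfolding q_def norm_add_square by (simp add: u w uw cinner_simps power2_eq_square)
  then have q: "norm q = 1"
    by (simp add: power2_eq_1_iff) (use norm_ge_zero[of q] in linarith)
  define P' where "P' = E - rank1 u + rank1 q"
  have "(E - rank1 u) q = 0"
    by (simp add: q_def blinfun.bilinear_simps rank1_apply cinner_simps wu uw u w cinner_self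
        scaleC_one scaleC_zero_left)
  then have P': "projection P'"
    unfolding P'_def by (intro projection_plus_rank1 projection_minus_rank1 P u q)
  note eff' = projection_effect[OF P']
  have diff: "P' - E = rank1 q - rank1 u"
    by (simp add: P'_def)
  have saD: "selfadjoint (P' - E)"
    by (intro selfadjoint_diff effects_selfadjoint eff' E)
  have close: "centre + (5/6) *\<^sub>R (P' - E) \<in> effects"
    unfolding half_add_effect_iff[OF saD]
  proof
    fix x
    define a b where "a = cinner x u" and "b = cinner x w"
    have real_bound: "\<bar>5/6 * ((4/5 * s + 3/5 * t)\<^sup>2 - s\<^sup>2)\<bar> \<le> (s\<^sup>2 + t\<^sup>2) / 2" for s t :: real
    proof -
      have "(s\<^sup>2 + t\<^sup>2) / 2 - 5/6 * ((4/5 * s + 3/5 * t)\<^sup>2 - s\<^sup>2) = 4/5 * (s - t / 2)\<^sup>2"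
        "(s\<^sup>2 + t\<^sup>2) / 2 + 5/6 * ((4/5 * s + 3/5 * t)\<^sup>2 - s\<^sup>2) = 1/5 * (s + 2 * t)\<^sup>2"
        by (simp_all add: power2_eq_square field_simps)
      then show ?thesis
        using zero_le_power2[of "s - t / 2"] zero_le_power2[of "s + 2 * t"] by linarith
    qed
    let ?d = "\<lambda>s t. 5/6 * ((4/5 * s + 3/5 * t)\<^sup>2 - s\<^sup>2)"
    have "qform (P' - E) x = ((4/5 * Re a + 3/5 * Re b)\<^sup>2 - (Re a)\<^sup>2)
        + ((4/5 * Im a + 3/5 * Im b)\<^sup>2 - (Im a)\<^sup>2)"
      by (simp add: diff qform_diff qform_rank1 q_def cinner_simps a_def b_def cmod_power2)
    then have "\<bar>5/6 * qform (P' - E) x\<bar> \<le> \<bar>?d (Re a) (Re b)\<bar> + \<bar>?d (Im a) (Im b)\<bar>"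
      by (simp only: distrib_left abs_triangle_ineq)
    also have "\<dots> \<le> ((Re a)\<^sup>2 + (Re b)\<^sup>2) / 2 + ((Im a)\<^sup>2 + (Im b)\<^sup>2) / 2"
      by (intro add_mono real_bound)
    also have "\<dots> \<le> (norm x)\<^sup>2 / 2"
      using Bessel_two[OF u(1) w(1) wu, of x] unfolding a_def b_def cmod_power2
      by (simp add: field_simps)
    finally show "\<bar>5/6 * qform (P' - E) x\<bar> \<le> (norm x)\<^sup>2 / 2" .
  qed
  have "\<phi> (centre + (5/6) *\<^sub>R (P' - E)) = centre + (5/6) *\<^sub>R \<phi> P'"
    using image_centre_add[OF saD close] image_diff[OF eff' E] image_centre zero by simp
  then have close': "centre + (5/6) *\<^sub>R \<phi> P' \<in> effects"
    using effect_image[OF close] by simp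
  have Q: "projection (\<phi> P')"
    using projection_image_iff[OF eff'] P' by simp
  have "qform (P' - E) w \<noteq> 0"
    by (simp add: diff qform_diff qform_rank1 q_def cinner_simps wu w cinner_self)
  then have "P' \<noteq> E"
    by (auto simp: qform_zero)
  then have "\<phi> P' \<noteq> 0"
    using image_eqD[OF _ eff' E] zero by metis
  then obtain z where z: "\<phi> P' z \<noteq> 0"
    by (metis blinfun_eqI zero_blinfun.rep_eq)
  let ?z = "\<phi> P' z"
  have "qform (\<phi> P') ?z = (norm ?z)\<^sup>2"
    using projection_qform[OF Q, of ?z] Q by (simp add: projection_def)
  moreover have "qform (centre + (5/6) *\<^sub>R \<phi> P') ?z \<le> (norm ?z)\<^sup>2"
    using close' by (simp only: effects_iff)
  ultimately have "(norm ?z)\<^sup>2 \<le> 0"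
    by (simp add: qform_simps)
  then show False
    using z by simp
qed

end

section \<open>Affine automorphisms fixing the zero effect\<close>

locale effect_automorphism = effect_symmetry +
  assumes image_zero: "\<phi> 0 = 0"
begin

lemma image_eq_lin: "E \<in> effects \<Longrightarrow> \<phi> E = lin E"
  using image_diff[OF _ zero_effect] image_zero by simp

lemma lin_id: "lin id_blinfun = id_blinfun"
  using image_complement[OF zero_effect] image_zero image_eq_lin[OF id_effect] by simp

lemma lin_zero: "lin 0 = 0"
  using image_eq_lin[OF zero_effect] image_zero by simp

lemma lin_nonneg:
  assumes A: "selfadjoint A" and pos: "\<And>x. 0 \<le> qform A x"
  shows "0 \<le> qform (lin A) x"
proof -
  define t where "t = 1 / (norm A + 1)"
  have t: "0 < t"
    by (simp add: t_def add_nonneg_pos)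
  have "t * qform A y \<le> (norm y)\<^sup>2" for y
  proof -
    have "qform A y \<le> (norm A + 1) * (norm y)\<^sup>2"
      using qform_bound[of A y] by (simp add: distrib_right abs_le_iff) (smt (verit) zero_le_power2)
    then show ?thesis
      using t by (simp add: t_def divide_le_eq mult.commute)
  qed
  then have "t *\<^sub>R A \<in> effects"
    using A pos t by (simp add: effects_iff selfadjoint_scaleR qform_scaleR)
  then have "0 \<le> qform (t *\<^sub>R lin A) x"
    using effect_image image_eq_lin lin_scaleR[OF A] by (metis effects_iff)
  then show ?thesis
    using t by (simp add: qform_scaleR zero_le_mult_iff)
qed

text \<open>The image \<open>Q\<close> of a one-dimensional projection is a nonzero projection. A line in the range of
  \<open>Q\<close> gives a projection below \<open>Q\<close>, and its preimage lies below the given projection, so it is a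
  multiple of it; hence \<open>Q\<close> has no further directions in its range.\<close>

lemma image_rank1_unit:
  assumes x: "norm x = 1"
  shows "\<exists>u. norm u = 1 \<and> \<phi> (rank1 x) = rank1 u"
proof -
  define Q where "Q = \<phi> (rank1 x)"
  note eff = projection_effect[OF projection_rank1[OF x]]
  have Q: "projection Q"
    using projection_image_iff[OF eff] projection_rank1[OF x] by (simp add: Q_def)
  have "qform (rank1 x) x \<noteq> 0"
    by (simp add: qform_rank1 cinner_self x)
  then have "rank1 x \<noteq> 0"
    by (auto simp: qform_zero)
  then have "Q \<noteq> 0"
    unfolding Q_def using image_eqD[OF _ eff zero_effect] image_zero by metis
  then obtain y where y: "Q y \<noteq> 0"
    by (metis blinfun_eqI zero_blinfun.rep_eq)
  define u where "u = (1 / norm (Q y)) *\<^sub>R Q y"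
  have u: "norm u = 1" "Q u = u"
    using y Q by (simp_all add: u_def blinfun.scaleR_right projection_def)
  obtain E where E: "E \<in> effects" "\<phi> E = rank1 u"
    using effect_preimage[OF projection_effect[OF projection_rank1[OF u(1)]]] by blast
  obtain F where F: "F \<in> effects" "\<phi> F = Q - rank1 u"
    using effect_preimage[OF projection_effect[OF projection_minus_rank1[OF Q u(2,1)]]] by blast
  have "\<phi> ((1/2) *\<^sub>R E + (1/2) *\<^sub>R F) = (1/2) *\<^sub>R \<phi> (rank1 x) + (1/2) *\<^sub>R \<phi> 0"
    using midpoint_image[OF E(1) F(1)] E(2) F(2)
    by (simp add: image_zero Q_def flip: scaleR_add_right)
  also have "\<dots> = \<phi> ((1/2) *\<^sub>R rank1 x + (1/2) *\<^sub>R 0)"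
    by (rule midpoint_image[OF eff zero_effect, symmetric])
  finally have "(1/2) *\<^sub>R E + (1/2) *\<^sub>R F = (1/2) *\<^sub>R rank1 x + (1/2) *\<^sub>R 0"
    by (rule image_eqD) (intro midpoint_effect E F eff zero_effect)+
  then have "(1/2) *\<^sub>R (E + F) = (1/2) *\<^sub>R rank1 x"
    by (simp add: scaleR_add_right)
  then have EF: "E + F = rank1 x"
    by simp
  have "qform E z \<le> qform (rank1 x) z" for z
    using F(1) by (simp add: qform_add effects_iff flip: EF)
  then obtain r where r: "E = r *\<^sub>R rank1 x"
    using effect_below_rank1[OF E(1) x] by blast
  have "rank1 u = r *\<^sub>R Q"
    using image_eq_lin[OF E(1)] E(2) lin_scaleR[OF selfadjoint_rank1, of r x] image_eq_lin[OF eff]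
    by (simp add: r Q_def)
  moreover from this have "u = r *\<^sub>R u"
    using rank1_self_apply[of u] u by (simp add: blinfun.scaleR_left)
  then have "r = 1"
    using u(1) by (metis norm_zero scaleR_cancel_right scaleR_one zero_neq_one)
  ultimately show ?thesis
    using u(1) by (auto simp: Q_def)
qed

text \<open>The key estimate. If \<open>P\<close> is the projection onto the line of \<open>x\<close> and \<open>a = \<langle>A x, x\<rangle>\<close>, completing
  the square bounds the off-diagonal blocks of \<open>A\<close> and gives
  \<open>A \<le> (1 + \<epsilon>) a P + (1 + 1/\<epsilon>) (I - P)\<close>. A positive unital map sending \<open>P\<close> to the projection onto
  the line of \<open>u\<close> turns this into a bound for its value at \<open>u\<close>, in which the second summand vanishes.\<close>

lemma qform_image_le:
  assumes x: "norm x = 1" and u: "norm u = 1" and xu: "\<phi> (rank1 x) = rank1 u"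
    and A: "A \<in> effects"
  shows "qform (\<phi> A) u \<le> qform A x"
proof (rule field_le_epsilon)
  fix \<delta> :: real assume \<delta>: "\<delta> > 0"
  have saA: "selfadjoint A" and a01: "0 \<le> qform A x" "qform A x \<le> 1"
    using A x by (auto simp: effects_iff dest: spec[of _ x])
  define X where "X = ((1 + \<delta>) * qform A x) *\<^sub>R rank1 x
    + (1 + 1 / \<delta>) *\<^sub>R (id_blinfun - rank1 x) - A"
  have saX: "selfadjoint X"
    unfolding X_def by (intro selfadjoint_intros selfadjoint_rank1 saA)
  have "0 \<le> qform X z" for z
  proof -
    define p y where "p = cinner z x *\<^sub>C x" and "y = z - p"
    have z: "z = p + y"
      by (simp add: p_def y_def)
    have qp: "qform A p = (cmod (cinner z x))\<^sup>2 * qform A x"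
      by (simp add: p_def qform_scaleC_arg[OF saA])
    have ny: "(norm y)\<^sup>2 = (norm z)\<^sup>2 - (cmod (cinner z x))\<^sup>2"
      unfolding y_def p_def by (rule norm_diff_component_square[OF x])
    have "0 \<le> qform A (\<delta> *\<^sub>R p + (-1) *\<^sub>R y)"
      using A by (simp add: effects_iff)
    also have "\<dots> = \<delta>\<^sup>2 * qform A p + qform A y - 2 * \<delta> * Re (cinner (A p) y)"
      by (simp only: qform_add_arg[OF saA] qform_scaleR_arg blinfun.scaleR_right)
        (simp add: cinner_simps)
    finally have "2 * Re (cinner (A p) y) \<le> \<delta> * qform A p + qform A y / \<delta>"
      using \<delta> by (simp add: field_simps power2_eq_square)
    moreover have "qform A z = qform A p + qform A y + 2 * Re (cinner (A p) y)"
      unfolding z by (rule qform_add_arg[OF saA])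
    ultimately have "qform A z \<le> (1 + \<delta>) * qform A p + (1 + 1 / \<delta>) * qform A y"
      by (simp add: algebra_simps)
    also have "\<dots> \<le> (1 + \<delta>) * qform A p + (1 + 1 / \<delta>) * (norm y)\<^sup>2"
      using A \<delta> by (intro add_left_mono mult_left_mono) (auto simp: effects_iff)
    finally show ?thesis
      by (simp add: X_def qform_simps qform_rank1 ny qp mult.commute mult.left_commute)
  qed
  then have "0 \<le> qform (lin X) u"
    by (rule lin_nonneg[OF saX])
  moreover have "lin X = ((1 + \<delta>) * qform A x) *\<^sub>R rank1 u
      + (1 + 1 / \<delta>) *\<^sub>R (id_blinfun - rank1 u) - \<phi> A"
    using image_eq_lin[OF projection_effect[OF projection_rank1[OF x]]] xu image_eq_lin[OF A]
    unfolding X_def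
    by (simp add: lin_diff lin_add lin_scaleR selfadjoint_intros selfadjoint_rank1 saA lin_id)
  ultimately have "qform (\<phi> A) u \<le> (1 + \<delta>) * qform A x"
    by (simp add: qform_simps qform_rank1 cinner_self u)
  also have "\<dots> \<le> qform A x + \<delta>"
    using a01(2) \<delta> mult_left_mono[of "qform A x" 1 \<delta>] by (simp add: distrib_right)
  finally show "qform (\<phi> A) u \<le> qform A x + \<delta>" .
qed

text \<open>The reverse inequality is the same one for \<open>I - A\<close>.\<close>

lemma qform_image:
  assumes "norm x = 1" "norm u = 1" "\<phi> (rank1 x) = rank1 u" "A \<in> effects"
  shows "qform (\<phi> A) u = qform A x"
  using qform_image_le[OF assms] qform_image_le[OF assms(1-3) complement_effect[OF assms(4)]]
  by (simp add: image_complement[OF assms(4)] qform_diff qform_id assms(1,2))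

lemma qform_lin_unit:
  assumes "norm x = 1" "norm u = 1" "\<phi> (rank1 x) = rank1 u" and A: "selfadjoint A"
  shows "qform (lin A) u = qform A x"
proof -
  obtain t where t: "t > 0" "centre + t *\<^sub>R A \<in> effects"
    using small_step[OF A] by (metis abs_of_pos order_refl)
  have "qform (centre + t *\<^sub>R lin A) u = qform (centre + t *\<^sub>R A) x"
    using qform_image[OF assms(1-3) t(2)] image_centre_add[OF A t(2)] by (simp add: image_centre)
  then show ?thesis
    using t(1) assms(1,2) by (simp add: qform_simps)
qed

lemma lin_rank1_exists:
  "\<exists>u. lin (rank1 x) = rank1 u \<and> (\<forall>A. selfadjoint A \<longrightarrow> qform (lin A) u = qform A x)"
proof (cases "x = 0")
  case True
  then show ?thesis
    by (intro exI[of _ 0]) (simp add: rank1_zero lin_zero qform_def cinner_simps)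
next
  case False
  define x' where "x' = (1 / norm x) *\<^sub>R x"
  have x': "norm x' = 1" and x: "x = norm x *\<^sub>R x'"
    using False by (simp_all add: x'_def)
  obtain u where u: "norm u = 1" "\<phi> (rank1 x') = rank1 u"
    using image_rank1_unit[OF x'] by blast
  have lin_u: "lin (rank1 x') = rank1 u"
    using image_eq_lin[OF projection_effect[OF projection_rank1[OF x']]] u(2) by simp
  show ?thesis
  proof (intro exI[of _ "norm x *\<^sub>R u"] conjI allI impI)
    show "lin (rank1 x) = rank1 (norm x *\<^sub>R u)"
      by (subst x) (simp only: rank1_scaleR lin_scaleR selfadjoint_rank1 lin_u)
    show "qform (lin A) (norm x *\<^sub>R u) = qform A x" if "selfadjoint A" for A
      by (subst (2) x) (simp only: qform_scaleR_arg qform_lin_unit[OF x' u that])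
  qed
qed

lemma qform_lin:
  assumes "lin (rank1 x) = rank1 u" "selfadjoint A"
  shows "qform (lin A) u = qform A x"
proof -
  obtain v where v: "lin (rank1 x) = rank1 v" "qform (lin A) v = qform A x"
    using lin_rank1_exists[of x] assms(2) by blast
  then obtain c where "cmod c = 1" "u = c *\<^sub>C v"
    using assms(1) rank1_eqD[of u v] by metis
  then show ?thesis
    using v(2) by (simp add: qform_scaleC_arg selfadjoint_lin assms(2))
qed

lemma cmod_cinner_lin:
  assumes "lin (rank1 x) = rank1 u" "lin (rank1 y) = rank1 v"
  shows "cmod (cinner u v) = cmod (cinner x y)"
  using qform_lin[OF assms(1) selfadjoint_rank1, of y] by (simp add: assms(2) qform_rank1)

lemma norm_lin:
  assumes "lin (rank1 x) = rank1 u"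
  shows "norm u = norm x"
  using qform_lin[OF assms selfadjoint_id] by (simp add: lin_id qform_id)

end


section \<open>A linear or conjugate-linear isometry implementing the automorphism\<close>

text \<open>If \<open>(B - C) (B + C)\<close> vanishes identically then one of the factors does: a group is not the union
  of two proper subgroups, and this applies in each variable in turn.\<close>

lemma biadditive_eq_or_eq_neg:
  fixes B C :: "'a::real_vector \<Rightarrow> 'a \<Rightarrow> real"
  assumes pointwise: "\<And>x y. x \<in> S \<Longrightarrow> y \<in> S \<Longrightarrow> B x y = C x y \<or> B x y = - C x y"
    and S: "\<And>x y. x \<in> S \<Longrightarrow> y \<in> S \<Longrightarrow> x + y \<in> S"
    and B_left: "\<And>x y z. x \<in> S \<Longrightarrow> y \<in> S \<Longrightarrow> z \<in> S \<Longrightarrow> B (x + y) z = B x z + B y z"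
    and B_right: "\<And>x y z. x \<in> S \<Longrightarrow> y \<in> S \<Longrightarrow> z \<in> S \<Longrightarrow> B x (y + z) = B x y + B x z"
    and C_left: "\<And>x y z. x \<in> S \<Longrightarrow> y \<in> S \<Longrightarrow> z \<in> S \<Longrightarrow> C (x + y) z = C x z + C y z"
    and C_right: "\<And>x y z. x \<in> S \<Longrightarrow> y \<in> S \<Longrightarrow> z \<in> S \<Longrightarrow> C x (y + z) = C x y + C x z"
  shows "(\<forall>x\<in>S. \<forall>y\<in>S. B x y = C x y) \<or> (\<forall>x\<in>S. \<forall>y\<in>S. B x y = - C x y)"
proof (rule ccontr)
  assume "\<not> ?thesis"
  then obtain x y x' y' where xy: "x \<in> S" "y \<in> S" "x' \<in> S" "y' \<in> S"
    and D: "B x y - C x y \<noteq> 0" and T: "B x' y' + C x' y' \<noteq> 0"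
    by (metis add.left_inverse eq_iff_diff_eq_0 eq_neg_iff_add_eq_0)
  have alt: "B a b - C a b = 0 \<or> B a b + C a b = 0" if "a \<in> S" "b \<in> S" for a b
    using pointwise[OF that] by auto
  have vary_right: "B a b - C a b = 0 \<or> B a b' + C a b' = 0"
    if "a \<in> S" "b \<in> S" "b' \<in> S" for a b b'
    using alt[OF that(1,2)] alt[OF that(1,3)] alt[OF that(1) S[OF that(2,3)]] that
    by (auto simp: B_right C_right)
  have vary_left: "B a b - C a b = 0 \<or> B a' b + C a' b = 0"
    if "a \<in> S" "a' \<in> S" "b \<in> S" for a a' b
    using alt[OF that(1,3)] alt[OF that(2,3)] alt[OF S[OF that(1,2)] that(3)] that
    by (auto simp: B_left C_left)
  have "B x y' + C x y' = 0" "B x' y - C x' y = 0"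
    using vary_right[of x y y'] vary_right[of x' y y'] D T xy by auto
  moreover have "B x' y + C x' y = 0" "B x y' - C x y' = 0"
    using vary_left[of x x' y] vary_left[of x x' y'] D T xy by auto
  ultimately show False
    using alt[OF S[OF xy(1,3)] S[OF xy(2,4)]] alt[OF xy(1,2)] alt[OF xy(3,4)] D T xy
    by (auto simp: B_left B_right C_left C_right S)
qed

text \<open>The linear and the conjugate-linear case are treated together: \<open>\<kappa>\<close> is the identity or the
  conjugation of scalars.\<close>

definition identity_or_cnj :: "(complex \<Rightarrow> complex) \<Rightarrow> bool"
  where "identity_or_cnj \<kappa> \<longleftrightarrow> \<kappa> = (\<lambda>c. c) \<or> \<kappa> = cnj"

lemma identity_or_cnj_simps:
  assumes "identity_or_cnj \<kappa>"
  shows "\<kappa> (c + d) = \<kappa> c + \<kappa> d" "\<kappa> (c - d) = \<kappa> c - \<kappa> d" "\<kappa> (c * d) = \<kappa> c * \<kappa> d"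
    "\<kappa> (cnj c) = cnj (\<kappa> c)" "\<kappa> (of_real r) = of_real r" "\<kappa> 0 = 0" "\<kappa> 1 = 1"
    "\<kappa> (\<kappa> c) = c" "cmod (\<kappa> c) = cmod c" "Re (\<kappa> c) = Re c"
  using assms by (auto simp: identity_or_cnj_def)

text \<open>The defects of additivity and of homogeneity are combinations of values of \<open>U\<close>, and the hypothesis
  makes them orthogonal to all values of \<open>U\<close>.\<close>

lemma isometry_add_scaleC:
  fixes U :: "'a::complex_inner \<Rightarrow> 'a"
  assumes \<kappa>: "identity_or_cnj \<kappa>" and iso: "\<And>x y. cinner (U x) (U y) = \<kappa> (cinner x y)"
  shows "U (x + y) = U x + U y" "U (c *\<^sub>C x) = \<kappa> c *\<^sub>C U x"
proof -
  let ?v = "U (x + y) - (U x + U y)"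
  have "cinner ?v (U z) = 0" for z
    by (simp add: cinner_simps iso identity_or_cnj_simps[OF \<kappa>])
  then have "cinner ?v ?v = 0"
    by (simp only: cinner_diff_right[of ?v] cinner_add_right[of ?v]) simp
  then show "U (x + y) = U x + U y"
    by (simp add: cinner_self_eq_zero)
  let ?w = "U (c *\<^sub>C x) - \<kappa> c *\<^sub>C U x"
  have "cinner ?w (U z) = 0" for z
    by (simp add: cinner_simps iso identity_or_cnj_simps[OF \<kappa>])
  then have "cinner ?w ?w = 0"
    by (simp only: cinner_diff_right[of ?w] cinner_scaleC_right[of ?w]) simp
  then show "U (c *\<^sub>C x) = \<kappa> c *\<^sub>C U x"
    by (simp add: cinner_self_eq_zero)
qed

text \<open>\<open>rank1\<close> is a real quadratic map. Its polarization is expressed here through its values only,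
  because the action of \<open>\<phi>\<close> is known on these values.\<close>

lemma rank1_add_three:
  "rank1 (x + y + z) + rank1 x + rank1 y + rank1 z =
    rank1 (x + y) + rank1 (x + z) + rank1 (y + z)"
  by (rule blinfun_eqI)
    (simp add: blinfun.add_left rank1_apply cinner_simps scaleC_add_left scaleC_add_right)

lemma rank1_add_scaleR:
  "rank1 (x + r *\<^sub>R y) = r *\<^sub>R rank1 (x + y) + (1 - r) *\<^sub>R rank1 x + (r\<^sup>2 - r) *\<^sub>R rank1 y"
proof (rule selfadjoint_eqI)
  fix z
  have "(cmod (a + of_real r * b))\<^sup>2 =
      r * (cmod (a + b))\<^sup>2 + (1 - r) * (cmod a)\<^sup>2 + (r\<^sup>2 - r) * (cmod b)\<^sup>2" for a b :: complex
    unfolding cmod_power2 by (simp add: power2_eq_square algebra_simps)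
  then show "qform (rank1 (x + r *\<^sub>R y)) z =
      qform (r *\<^sub>R rank1 (x + y) + (1 - r) *\<^sub>R rank1 x + (r\<^sup>2 - r) *\<^sub>R rank1 y) z"
    by (simp add: qform_simps qform_rank1 cinner_simps)
qed (intro selfadjoint_intros selfadjoint_rank1)+

lemma rank1_parallelogram: "rank1 (x + y) + rank1 (x - y) = 2 *\<^sub>R rank1 x + 2 *\<^sub>R rank1 y"
  using rank1_add_scaleR[of x "-1" y] by (simp add: scaleR_2)

text \<open>A unit vector \<open>e\<close> with a chosen image \<open>f\<close>, which removes the freedom of a phase: the image of
  \<open>e + x\<close>, for \<open>x\<close> orthogonal to \<open>e\<close>, is normalised by having component \<open>1\<close> along \<open>f\<close>. The map
  \<open>shift\<close> is the rest of that image; it is read off from the linear map \<open>lin\<close> and so inherits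
  real linearity from it.\<close>

locale pointed_automorphism = effect_automorphism +
  fixes e f :: 'a
  assumes norm_e: "norm e = 1"
    and lin_e: "lin (rank1 e) = rank1 f"
begin

definition shift :: "'a \<Rightarrow> 'a"
  where "shift x = lin (rank1 (e + x)) f - f"

lemma norm_f: "norm f = 1"
  using norm_lin[OF lin_e] norm_e by simp

lemma rank1_f_apply: "rank1 f f = f"
  by (simp add: rank1_self_apply norm_f)

lemma lin_perp_apply:
  assumes "cinner x e = 0"
  shows "lin (rank1 x) f = 0"
proof -
  obtain u where u: "lin (rank1 x) = rank1 u"
    using lin_rank1_exists by blast
  have "cinner f u = 0"
    using cmod_cinner_lin[OF u lin_e] assms cinner_commute[of f u] by simp
  then show ?thesis
    by (simp add: u rank1_apply scaleC_zero_left)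
qed

lemma shift_props:
  assumes x: "cinner x e = 0"
  shows "cinner (shift x) f = 0" "lin (rank1 (e + x)) = rank1 (f + shift x)"
proof -
  obtain w where w: "lin (rank1 (e + x)) = rank1 w"
    using lin_rank1_exists by blast
  have one: "cmod (cinner w f) = 1"
    using cmod_cinner_lin[OF w lin_e] x by (simp add: cinner_simps cinner_self norm_e)
  define v where "v = cnj (cinner w f) *\<^sub>C w"
  have v: "lin (rank1 (e + x)) = rank1 v"
    by (simp add: v_def rank1_scaleC one w)
  have vf: "cinner v f = 1"
    using one complex_norm_square[of "cinner w f"] by (simp add: v_def cinner_simps mult.commute)
  then have "cinner f v = 1"
    using cinner_commute[of f v] by simp
  then have shift: "shift x = v - f"
    by (simp add: shift_def v rank1_apply scaleC_one)
  show "cinner (shift x) f = 0" "lin (rank1 (e + x)) = rank1 (f + shift x)"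
    by (simp_all add: shift cinner_simps vf cinner_self norm_f v)
qed

lemma shift_add:
  assumes x: "cinner x e = 0" and y: "cinner y e = 0"
  shows "shift (x + y) = shift x + shift y"
proof -
  have "lin (rank1 (e + x + y)) + lin (rank1 e) + lin (rank1 x) + lin (rank1 y) =
      lin (rank1 (e + x)) + lin (rank1 (e + y)) + lin (rank1 (x + y))"
    using arg_cong[OF rank1_add_three[of e x y], of lin]
    by (simp add: lin_add selfadjoint_rank1 selfadjoint_add)
  then have "(lin (rank1 (e + x + y)) + lin (rank1 e) + lin (rank1 x) + lin (rank1 y)) f =
      (lin (rank1 (e + x)) + lin (rank1 (e + y)) + lin (rank1 (x + y))) f"
    by simp
  then have "lin (rank1 (e + x + y)) f + f = lin (rank1 (e + x)) f + lin (rank1 (e + y)) f"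
    by (simp add: blinfun.add_left lin_perp_apply x y cinner_simps lin_e rank1_f_apply)
  then show ?thesis
    by (simp add: shift_def add.assoc algebra_simps)
qed

lemma shift_scaleR:
  assumes x: "cinner x e = 0"
  shows "shift (r *\<^sub>R x) = r *\<^sub>R shift x"
proof -
  have "lin (rank1 (e + r *\<^sub>R x)) =
      r *\<^sub>R lin (rank1 (e + x)) + (1 - r) *\<^sub>R lin (rank1 e) + (r\<^sup>2 - r) *\<^sub>R lin (rank1 x)"
    unfolding rank1_add_scaleR
    by (simp add: lin_add lin_scaleR selfadjoint_rank1 selfadjoint_add selfadjoint_scaleR)
  then have "lin (rank1 (e + r *\<^sub>R x)) f = r *\<^sub>R lin (rank1 (e + x)) f + (1 - r) *\<^sub>R f"
    by (simp add: blinfun.add_left blinfun.scaleR_left lin_perp_apply x lin_e rank1_f_apply)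
  then show ?thesis
    by (simp add: shift_def algebra_simps)
qed

lemma lin_rank1_shift:
  assumes x: "cinner x e = 0"
  shows "lin (rank1 x) = rank1 (shift x)"
proof -
  have neg: "shift (- x) = - shift x"
    using shift_scaleR[OF x, of "-1"] by simp
  have "lin (rank1 (e + x)) + lin (rank1 (e - x)) = 2 *\<^sub>R lin (rank1 e) + 2 *\<^sub>R lin (rank1 x)"
    using arg_cong[OF rank1_parallelogram[of e x], of lin]
    by (simp add: lin_add lin_scaleR selfadjoint_rank1 selfadjoint_scaleR)
  moreover have "lin (rank1 (e - x)) = rank1 (f - shift x)"
    using shift_props(2)[of "- x"] x by (simp add: cinner_simps neg)
  ultimately have "2 *\<^sub>R rank1 (shift x) = 2 *\<^sub>R lin (rank1 x)"
    using rank1_parallelogram[of f "shift x"] shift_props(2)[OF x] lin_e by simp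
  then show ?thesis
    by simp
qed

lemma Re_cinner_shift:
  assumes x: "cinner x e = 0" and y: "cinner y e = 0"
  shows "Re (cinner (shift x) (shift y)) = Re (cinner x y)"
proof -
  have norm_shift: "norm (shift z) = norm z" if "cinner z e = 0" for z
    by (rule norm_lin[OF lin_rank1_shift[OF that]])
  have "norm (shift x + shift y) = norm (x + y)"
    using norm_shift[of "x + y"] x y by (simp add: cinner_simps shift_add)
  then show ?thesis
    using norm_add_square[of "shift x" "shift y"] norm_add_square[of x y]
    by (simp add: norm_shift x y)
qed

text \<open>Equal moduli and equal real parts leave only a sign for each imaginary part, and both
  imaginary parts are real bilinear, so the sign is the same throughout.\<close>

lemma cinner_shift:
  "\<exists>\<kappa>. identity_or_cnj \<kappa> \<and>
    (\<forall>x y. cinner x e = 0 \<longrightarrow> cinner y e = 0 \<longrightarrow> cinner (shift x) (shift y) = \<kappa> (cinner x y))"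
proof -
  let ?S = "{x. cinner x e = 0}"
  have "(\<forall>x\<in>?S. \<forall>y\<in>?S. Im (cinner (shift x) (shift y)) = Im (cinner x y)) \<or>
      (\<forall>x\<in>?S. \<forall>y\<in>?S. Im (cinner (shift x) (shift y)) = - Im (cinner x y))"
  proof (rule biadditive_eq_or_eq_neg)
    fix x y assume "x \<in> ?S" "y \<in> ?S"
    then have x: "cinner x e = 0" and y: "cinner y e = 0"
      by simp_all
    have "(cmod (cinner (shift x) (shift y)))\<^sup>2 = (cmod (cinner x y))\<^sup>2"
      using cmod_cinner_lin[OF lin_rank1_shift[OF x] lin_rank1_shift[OF y]] by simp
    then have "(Im (cinner (shift x) (shift y)))\<^sup>2 = (Im (cinner x y))\<^sup>2"
      by (simp add: cmod_power2 Re_cinner_shift[OF x y])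
    then show "Im (cinner (shift x) (shift y)) = Im (cinner x y) \<or>
        Im (cinner (shift x) (shift y)) = - Im (cinner x y)"
      by (simp add: power2_eq_iff)
  qed (simp_all add: cinner_simps shift_add)
  then show ?thesis
  proof
    assume "\<forall>x\<in>?S. \<forall>y\<in>?S. Im (cinner (shift x) (shift y)) = Im (cinner x y)"
    then show ?thesis
      by (intro exI[of _ "\<lambda>c. c"]) (simp add: identity_or_cnj_def complex_eq_iff Re_cinner_shift)
  next
    assume "\<forall>x\<in>?S. \<forall>y\<in>?S. Im (cinner (shift x) (shift y)) = - Im (cinner x y)"
    then show ?thesis
      by (intro exI[of _ cnj]) (simp add: identity_or_cnj_def complex_eq_iff Re_cinner_shift)
  qed
qed

lemma isometry_exists:
  "\<exists>U \<kappa>. identity_or_cnj \<kappa> \<and> (\<forall>x y. cinner (U x) (U y) = \<kappa> (cinner x y)) \<and>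
    (\<forall>x. lin (rank1 x) = rank1 (U x))"
proof -
  obtain \<kappa> where \<kappa>: "identity_or_cnj \<kappa>"
    and shift: "\<And>x y. cinner x e = 0 \<Longrightarrow> cinner y e = 0 \<Longrightarrow>
      cinner (shift x) (shift y) = \<kappa> (cinner x y)"
    using cinner_shift by blast
  note [simp] = identity_or_cnj_simps[OF \<kappa>]
  define perp where "perp x = x - cinner x e *\<^sub>C e" for x
  define U where "U x = \<kappa> (cinner x e) *\<^sub>C f + shift (perp x)" for x
  have perp: "cinner (perp x) e = 0" for x
    by (simp add: perp_def cinner_simps cinner_self norm_e)
  have f_shift: "cinner (shift (perp x)) f = 0" "cinner f (shift (perp x)) = 0" for x
    using shift_props(1)[OF perp] cinner_commute[of f "shift (perp x)"] by simp_all
  have iso: "cinner (U x) (U y) = \<kappa> (cinner x y)" for x y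
  proof -
    have "cinner (perp x) (perp y) = cinner x y - cinner x e * cnj (cinner y e)"
      by (simp add: perp_def cinner_simps cinner_self norm_e flip: cinner_commute)
    then have "cinner (shift (perp x)) (shift (perp y)) =
        \<kappa> (cinner x y) - \<kappa> (cinner x e) * cnj (\<kappa> (cinner y e))"
      using shift[OF perp perp, of x y] by simp
    then show ?thesis
      by (simp add: U_def cinner_add_left cinner_add_right cinner_scaleC_left cinner_scaleC_right
          f_shift cinner_self norm_f)
  qed
  have "lin (rank1 x) = rank1 (U x)" for x
  proof (cases "cinner x e = 0")
    case True
    then show ?thesis
      by (simp add: U_def perp_def scaleC_zero_left lin_rank1_shift)
  next
    case False
    \<comment> \<open>Rescaling the component along \<open>e\<close> to \<open>1\<close> reduces to the vectors \<open>e + y\<close>.\<close>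
    define a y where "a = cinner x e" and "y = (1 / a) *\<^sub>C x"
    have x: "x = a *\<^sub>C y"
      using False by (simp add: a_def y_def scaleC_scaleC scaleC_one)
    have ye: "cinner y e = 1"
      using False by (simp add: a_def y_def cinner_simps)
    have "lin (rank1 y) = rank1 (U y)"
      using shift_props(2)[OF perp[of y]] by (simp add: U_def ye perp_def scaleC_one)
    then show ?thesis
      unfolding x isometry_add_scaleC(2)[OF \<kappa> iso] rank1_scaleC
      by (simp add: lin_scaleR selfadjoint_rank1)
  qed
  then show ?thesis
    using \<kappa> iso by blast
qed

end

context effect_automorphism
begin

lemma isometry_surj:
  assumes \<kappa>: "identity_or_cnj \<kappa>" and iso: "\<And>x y. cinner (U x) (U y) = \<kappa> (cinner x y)"
    and U: "\<And>x. lin (rank1 x) = rank1 (U x)"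
  shows "surj U"
proof -
  have unit: "\<exists>z. U z = w" if w: "norm w = 1" for w
  proof -
    note eff_w = projection_effect[OF projection_rank1[OF w]]
    obtain E where E: "E \<in> effects" "\<phi> E = rank1 w"
      using effect_preimage[OF eff_w] by blast
    have P: "projection E"
      using projection_image_iff[OF E(1)] E(2) projection_rank1[OF w] by simp
    have "E \<noteq> 0"
      using E(2) image_zero rank1_self_apply[of w] w by force
    then obtain y where y: "E y \<noteq> 0"
      by (metis blinfun_eqI zero_blinfun.rep_eq)
    define z where "z = (1 / norm (E y)) *\<^sub>R E y"
    have z: "norm z = 1" "E z = z"
      using y P by (simp_all add: z_def blinfun.scaleR_right projection_def)
    have "qform (lin E) (U z) = qform E z"
      by (rule qform_lin[OF U effects_selfadjoint[OF E(1)]])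
    then have "(cmod (cinner w (U z)))\<^sup>2 = 1"
      using projection_qform[OF P, of z] z E
      by (simp add: image_eq_lin[symmetric] qform_rank1 norm_cinner_commute[of w])
    moreover have "norm (U z) = 1"
      using norm_lin[OF U] z(1) by simp
    ultimately have "w = cinner w (U z) *\<^sub>C U z"
      using norm_diff_component_square[of "U z" w] w by simp
    then have "w = U (\<kappa> (cinner w (U z)) *\<^sub>C z)"
      by (simp add: isometry_add_scaleC(2)[OF \<kappa> iso] identity_or_cnj_simps[OF \<kappa>])
    then show ?thesis
      by metis
  qed
  have "\<exists>z. U z = w" for w
  proof (cases "w = 0")
    case True
    then show ?thesis
      using isometry_add_scaleC(2)[OF \<kappa> iso, of 0 0]
      by (intro exI[of _ 0]) (simp add: identity_or_cnj_simps[OF \<kappa>] scaleC_zero_left)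
  next
    case False
    then obtain z where z: "U z = (1 / norm w) *\<^sub>R w"
      using unit[of "(1 / norm w) *\<^sub>R w"] by auto
    have "U (of_real (norm w) *\<^sub>C z) = w"
      using False unfolding isometry_add_scaleC(2)[OF \<kappa> iso] identity_or_cnj_simps(5)[OF \<kappa>] z
      by (simp flip: scaleR_scaleC)
    then show ?thesis ..
  qed
  then show ?thesis
    by (metis surjI)
qed

text \<open>Once \<open>\<phi>\<close> and conjugation by \<open>U\<close> agree on the operators \<open>rank1 x\<close>, the key estimate says that
  the quadratic forms of \<open>\<phi> A\<close> and \<open>U A U\<^sup>*\<close> agree, and polarization gives the operators.\<close>

lemma image_apply_isometry:
  assumes \<kappa>: "identity_or_cnj \<kappa>" and iso: "\<And>x y. cinner (U x) (U y) = \<kappa> (cinner x y)"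
    and U: "\<And>x. lin (rank1 x) = rank1 (U x)" and A: "A \<in> effects"
  shows "\<phi> A (U x) = U (A x)"
proof -
  note sa = effects_selfadjoint[OF A] and sa' = selfadjoint_image[OF A]
  have q: "qform (\<phi> A) (U z) = qform A z" for z
    using qform_lin[OF U sa] image_eq_lin[OF A] by simp
  have polar: "Re (cinner (\<phi> A (U x)) (U y)) = Re (cinner (U (A x)) (U y))" for y
    using qform_add_arg[OF sa, of x y] qform_add_arg[OF sa', of "U x" "U y"] q[of "x + y"] q[of x]
      q[of y]
    by (simp add: isometry_add_scaleC(1)[OF \<kappa> iso] iso identity_or_cnj_simps[OF \<kappa>])
  obtain y where y: "U y = \<phi> A (U x) - U (A x)"
    using isometry_surj[OF \<kappa> iso U] by (metis surjD)
  have "Re (cinner (\<phi> A (U x) - U (A x)) (\<phi> A (U x) - U (A x))) = 0"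
    using polar[of y] unfolding y by (simp add: cinner_diff_left)
  then show ?thesis
    by (simp add: cinner_self)
qed

lemma unitary_or_antiunitary_isometry:
  assumes \<kappa>: "identity_or_cnj \<kappa>" and iso: "\<And>x y. cinner (U x) (U y) = \<kappa> (cinner x y)"
    and "surj U"
  shows "unitary U \<or> antiunitary U"
proof -
  note lin_U = isometry_add_scaleC[OF \<kappa> iso]
  have "inj U"
  proof (rule injI)
    fix x y assume "U x = U y"
    have "U (x - y) + U y = U x"
      by (simp flip: lin_U(1))
    then have "U (x - y) = 0"
      using \<open>U x = U y\<close> by simp
    then have "\<kappa> (of_real ((norm (x - y))\<^sup>2)) = 0"
      by (simp only: cinner_self[symmetric] iso[symmetric]) (simp add: cinner_simps)
    then show "x = y"
      by (simp only: identity_or_cnj_simps[OF \<kappa>]) simp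
  qed
  then have bij: "bij U"
    using assms(3) by (simp add: bij_def)
  from \<kappa> consider "\<kappa> = (\<lambda>c. c)" | "\<kappa> = cnj"
    unfolding identity_or_cnj_def by blast
  then show ?thesis
  proof cases
    case 1
    then have "unitary U"
      using bij iso lin_U unfolding unitary_def
      by (simp add: Vector_Spaces.linear_iff vector_space_scaleC)
    then show ?thesis ..
  next
    case 2
    then have "antiunitary U"
      using bij iso lin_U unfolding antiunitary_def antilinear_def by simp
    then show ?thesis ..
  qed
qed

lemma implemented:
  "\<exists>U. (unitary U \<or> antiunitary U) \<and> (\<forall>A\<in>effects. blinfun_apply (\<phi> A) = U \<circ> A \<circ> op_adjoint U)"
proof (cases "\<exists>e0::'a. e0 \<noteq> 0")
  case True
  then obtain e0 :: 'a where "e0 \<noteq> 0" ..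
  then obtain e :: 'a where e: "norm e = 1"
    by (metis norm_sgn)
  obtain f where f: "lin (rank1 e) = rank1 f"
    using lin_rank1_exists by blast
  interpret pointed_automorphism \<phi> e f
    by unfold_locales (rule e f)+
  obtain U \<kappa> where \<kappa>: "identity_or_cnj \<kappa>" and iso: "\<And>x y. cinner (U x) (U y) = \<kappa> (cinner x y)"
    and U: "\<And>x. lin (rank1 x) = rank1 (U x)"
    using isometry_exists by blast
  have surj: "surj U"
    by (rule isometry_surj[OF \<kappa> iso U])
  have unit: "unitary U \<or> antiunitary U"
    by (rule unitary_or_antiunitary_isometry[OF \<kappa> iso surj])
  have "op_adjoint U = inv U"
    using unit op_adjoint_unitary(1) op_adjoint_antiunitary(1) by blast
  then have "blinfun_apply (\<phi> A) = U \<circ> A \<circ> op_adjoint U" if "A \<in> effects" for A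
    using image_apply_isometry[OF \<kappa> iso U that] surj_f_inv_f[OF surj]
    by (metis (no_types, lifting) comp_apply ext)
  then show ?thesis
    using unit by blast
next
  case False
  then have zero: "x = y" for x y :: 'a
    by metis
  have "unitary (\<lambda>x::'a. x)"
    by (simp add: unitary_def Vector_Spaces.linear_iff vector_space_scaleC bij_def inj_def)
  then show ?thesis
    using zero by (intro exI[of _ "\<lambda>x. x"]) (auto simp: fun_eq_iff)
qed

end

section \<open>Reduction to automorphisms fixing the zero effect\<close>

theorem corollary2:
  fixes \<phi> :: "('a::chilbert_space \<Rightarrow>\<^sub>L 'a) \<Rightarrow> ('a \<Rightarrow>\<^sub>L 'a)"
  assumes "bij_betw \<phi> effects effects"
    and "affine_on effects \<phi>"
  shows "\<exists>U :: 'a \<Rightarrow> 'a. (unitary U \<or> antiunitary U) \<and>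
    ((\<forall>A\<in>effects. blinfun_apply (\<phi> A) = U \<circ> blinfun_apply A \<circ> op_adjoint U) \<or>
     (\<forall>A\<in>effects. blinfun_apply (\<phi> A) = U \<circ> blinfun_apply (id_blinfun - A) \<circ> op_adjoint U))"
proof -
  interpret effect_symmetry \<phi>
    using assms by unfold_locales
  obtain E where E: "E \<in> effects" "\<phi> E = 0"
    using effect_preimage[OF zero_effect] by blast
  from zero_preimage[OF E] show ?thesis
  proof
    assume "E = 0"
    then interpret effect_automorphism \<phi>
      using E by unfold_locales simp
    show ?thesis
      using implemented by blast
  next
    assume "E = id_blinfun"
    define \<psi> where "\<psi> A = \<phi> (id_blinfun - A)" for A
    have "bij_betw (\<lambda>A. id_blinfun - A) effects effects"
      by (rule bij_betwI[where g = "\<lambda>A. id_blinfun - A"]) (auto intro: complement_effect)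
    then have "bij_betw \<psi> effects effects"
      using bij_betw_trans[OF _ bij] unfolding \<psi>_def comp_def by blast
    moreover have "affine_on effects \<psi>"
      unfolding affine_on_def
    proof (intro ballI)
      fix A B :: "'a \<Rightarrow>\<^sub>L 'a" and t :: real
      assume AB: "A \<in> effects" "B \<in> effects" and t: "t \<in> {0..1}"
      have "id_blinfun - (t *\<^sub>R A + (1 - t) *\<^sub>R B) =
          t *\<^sub>R (id_blinfun - A) + (1 - t) *\<^sub>R (id_blinfun - B)"
        by (simp add: algebra_simps)
      then show "\<psi> (t *\<^sub>R A + (1 - t) *\<^sub>R B) = t *\<^sub>R \<psi> A + (1 - t) *\<^sub>R \<psi> B"
        using affineD[OF AB[THEN complement_effect], of t] t by (simp add: \<psi>_def)
    qed
    moreover have "\<psi> 0 = 0"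
      using E(2) \<open>E = id_blinfun\<close> by (simp add: \<psi>_def)
    ultimately interpret \<psi>: effect_automorphism \<psi>
      by unfold_locales
    obtain U where U: "unitary U \<or> antiunitary U"
      and eq: "\<And>A. A \<in> effects \<Longrightarrow> blinfun_apply (\<psi> A) = U \<circ> A \<circ> op_adjoint U"
      using \<psi>.implemented by blast
    have "blinfun_apply (\<phi> A) = U \<circ> blinfun_apply (id_blinfun - A) \<circ> op_adjoint U"
      if "A \<in> effects" for A
      using eq[OF complement_effect[OF that]] by (simp add: \<psi>_def)
    then show ?thesis
      using U by blast
  qed
qed

end
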